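(* Let $(R,\mathfrak{m},k)$ be a Noetherian local ring of prime characteristic $p$ containing a coefficient field $k$. Let $M$ be an Artinian $R$-module which admits an injective Frobenius action $F: M\to M$. Then $M$ is $F$-stable if and only if $M_s\neq 0$. Also, $M_s\subseteq \mathrm{Soc}_R(M)$.
   Context: $(R,\mathfrak{m},k)$ denotes a local ring with maximal ideal $\mathfrak m$ and residue field $k$. A coefficient field is a subfield $k\subseteq R$ such that the composition $k\hookrightarrow R\to R/\mathfrak{m}$ is an isomorphism (used to identify $k$ with $R/\mathfrak m$). A Frobenius action on an $R$-module $M$ is an additive map $F:M\to M$ with $F(rm)=r^pF(m)$ for all $r\in R$, $m\in M$; $F^e$ is its $e$-fold iterate. Let $S=\mathrm{Soc}_R(M)=\{x\in M:\mathfrak{m}x=0\}$ and $F^e(S)=\{F^e(m): m\in S\}$. $M$ is $F$-unstable if there exists $N>0$ such that $S\cap F^e(S)=0$ for all $e\ge N$ (so the zero module is $F$-unstable); $M$ is $F$-stable if it is not $F$-unstable. For $j\geq 1$ let $F^j(M)=\{F^j(m):m\in M\}$ and let $\langle F^j(M)\rangle_k$ be the $k$-vector subspace of $M$ spanned by $F^j(M)$. The stable part of $M$ is $M_s=\bigcap_{j\ge 1}\langle F^j(M)\rangle_k$. *)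

theory Defs
  imports "HOL-Algebra.Algebra"
begin

definition local_ring :: "('a, 'c) ring_scheme \<Rightarrow> 'a set \<Rightarrow> bool" where
  "local_ring R \<mm> \<longleftrightarrow>
     cring R \<and> maximalideal \<mm> R \<and> (\<forall>J. maximalideal J R \<longrightarrow> J = \<mm>)"

definition has_characteristic :: "('a, 'c) ring_scheme \<Rightarrow> nat \<Rightarrow> bool" where
  "has_characteristic R p \<longleftrightarrow> (\<forall>n::nat. [n] \<cdot>\<^bsub>R\<^esub> \<one>\<^bsub>R\<^esub> = \<zero>\<^bsub>R\<^esub> \<longleftrightarrow> p dvd n)"

definition coefficient_field :: "('a, 'c) ring_scheme \<Rightarrow> 'a set \<Rightarrow> 'a set \<Rightarrow> bool" where
  "coefficient_field R \<mm> K \<longleftrightarrow>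
     subfield K R \<and> (\<lambda>x. \<mm> +>\<^bsub>R\<^esub> x) \<in> ring_iso (R\<lparr>carrier := K\<rparr>) (R Quot \<mm>)"

definition artinian_module :: "('a, 'c) ring_scheme \<Rightarrow> ('a, 'b, 'd) module_scheme \<Rightarrow> bool" where
  "artinian_module R M \<longleftrightarrow>
     module R M \<and>
     (\<forall>N::nat \<Rightarrow> 'b set.
        (\<forall>i. submodule (N i) R M) \<and> (\<forall>i. N (Suc i) \<subseteq> N i)
          \<longrightarrow> (\<exists>n. \<forall>i\<ge>n. N i = N n))"

definition frobenius_action ::
    "('a, 'c) ring_scheme \<Rightarrow> nat \<Rightarrow> ('a, 'b, 'd) module_scheme \<Rightarrow> ('b \<Rightarrow> 'b) \<Rightarrow> bool" where
  "frobenius_action R p M F \<longleftrightarrow>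
     F \<in> carrier M \<rightarrow> carrier M \<and>
     (\<forall>x\<in>carrier M. \<forall>y\<in>carrier M. F (x \<oplus>\<^bsub>M\<^esub> y) = F x \<oplus>\<^bsub>M\<^esub> F y) \<and>
     (\<forall>r\<in>carrier R. \<forall>x\<in>carrier M. F (r \<odot>\<^bsub>M\<^esub> x) = (r [^]\<^bsub>R\<^esub> p) \<odot>\<^bsub>M\<^esub> F x)"

definition socle :: "'a set \<Rightarrow> ('a, 'b, 'd) module_scheme \<Rightarrow> 'b set" where
  "socle \<mm> M = {x \<in> carrier M. \<forall>r\<in>\<mm>. r \<odot>\<^bsub>M\<^esub> x = \<zero>\<^bsub>M\<^esub>}"

definition F_unstable :: "'a set \<Rightarrow> ('a, 'b, 'd) module_scheme \<Rightarrow> ('b \<Rightarrow> 'b) \<Rightarrow> bool" where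
  "F_unstable \<mm> M F \<longleftrightarrow>
     (\<exists>N>0. \<forall>e\<ge>N. socle \<mm> M \<inter> (F ^^ e) ` socle \<mm> M = {\<zero>\<^bsub>M\<^esub>})"

definition F_stable :: "'a set \<Rightarrow> ('a, 'b, 'd) module_scheme \<Rightarrow> ('b \<Rightarrow> 'b) \<Rightarrow> bool" where
  "F_stable \<mm> M F \<longleftrightarrow> \<not> F_unstable \<mm> M F"

text \<open>For a subfield \<open>K\<close> of \<open>R\<close>, the \<open>K\<close>-subspaces of \<open>M\<close> are its submodules
  over the ring \<open>R\<lparr>carrier := K\<rparr>\<close>.\<close>

definition subspace_span ::
    "('a, 'c) ring_scheme \<Rightarrow> 'a set \<Rightarrow> ('a, 'b, 'd) module_scheme \<Rightarrow> 'b set \<Rightarrow> 'b set" where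
  "subspace_span R K M A = \<Inter> {V. submodule V (R\<lparr>carrier := K\<rparr>) M \<and> A \<subseteq> V}"

definition stable_part ::
    "('a, 'c) ring_scheme \<Rightarrow> 'a set \<Rightarrow> ('a, 'b, 'd) module_scheme \<Rightarrow> ('b \<Rightarrow> 'b) \<Rightarrow> 'b set" where
  "stable_part R K M F = (\<Inter>j\<in>{1..}. subspace_span R K M ((F ^^ j) ` carrier M))"

end

theory Submission
  imports Defs
begin

text \<open>
  Let \<open>x\<close> lie in the stable part, and let \<open>r\<close> run through generators of the maximal ideal.
  If some \<open>F\<^sup>J x\<close> is a \<open>K\<close>-combination of \<open>x, F x, \<dots>, F\<^sup>J\<^sup>-\<^sup>1 x\<close>, then the orbit of \<open>x\<close> spans a
  finite-dimensional \<open>F\<close>-stable subspace, so it is killed by a fixed power \<open>r\<^sup>t\<close>. With \<open>q = p\<^sup>t \<ge> t\<close>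
  we get \<open>F\<^sup>t (r F\<^sup>a x) = r\<^sup>q F\<^sup>t\<^sup>+\<^sup>a x = 0\<close>, and injectivity of \<open>F\<close> puts the whole orbit into the socle.

  The linear dependence is a Hilbert basis argument over the perfect closure \<open>L\<close> of \<open>K\<close>: inside the
  \<open>L\<close>-span of \<open>M\<close> in the limit of \<open>M\<close> along \<open>F\<close>, the submodules \<open>W\<^sub>i\<close> spanned by the elements
  \<open>F\<^sup>-\<^sup>a x\<close>, \<open>a \<ge> i\<close>, form a descending chain. Filter \<open>M\<close> lexicographically by \<open>K\<close>-subspaces with factors
  of dimension at most one. The exponents of the leading terms of \<open>W\<^sub>i\<close> form a set closed under passing
  to smaller exponents, so by Dickson's lemma these sets, and hence the \<open>W\<^sub>i\<close>, become stationary.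
  Applying high powers of \<open>F\<close> expresses all of this inside \<open>M\<close>, without constructing \<open>L\<close>.

  Conversely, if \<open>M\<close> is \<open>F\<close>-stable, then the descending chain condition on the socle yields first a
  nonzero \<open>x\<close> with its whole orbit in the socle, and then a nonzero \<open>F\<^sup>N x\<close> in the stable part.
\<close>

section \<open>Dickson's lemma\<close>

text \<open>Every sequence has a monotone subsequence. A nonincreasing one attains its minimum at
  some \<open>N\<close> and is constant from there on, so a shift by \<open>N\<close> makes it
  nondecreasing.\<close>

lemma mono_subseq_nat:
  fixes f :: "nat \<Rightarrow> nat"
  obtains g :: "nat \<Rightarrow> nat" where "strict_mono g" "mono (f \<circ> g)"
proof -
  obtain g where g: "strict_mono g" "monoseq (\<lambda>n. f (g n))"
    using seq_monosub by blast
  show thesis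
  proof (cases "\<forall>m. \<forall>n\<ge>m. f (g m) \<le> f (g n)")
    case True
    then have "mono (f \<circ> g)"
      by (auto intro!: monoI)
    then show thesis
      using g that by blast
  next
    case False
    then have dec: "f (g n) \<le> f (g m)" if "m \<le> n" for m n
      using g(2) that by (auto simp: monoseq_def)
    obtain N where N: "\<And>n. f (g N) \<le> f (g n)"
      using ex_has_least_nat[of "\<lambda>_. True" 0 "\<lambda>n. f (g n)"] by auto
    have "f (g (n + N)) = f (g N)" for n
      using dec[of N "n + N"] N[of "n + N"] by simp
    then have "mono (f \<circ> (\<lambda>n. g (n + N)))"
      by (auto intro!: monoI)
    moreover have "strict_mono (\<lambda>n. g (n + N))"
      using g(1) by (auto simp: strict_mono_def)
    ultimately show thesis
      using that by blast
  qed
qed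

text \<open>The last entry of an exponent indexes a step of a finite flag, so it is compared by equality.\<close>

fun exponent_le :: "nat list \<Rightarrow> nat list \<Rightarrow> bool" where
  "exponent_le (a # u) (b # v) \<longleftrightarrow>
    (if u = [] \<or> v = [] then a = b \<and> u = v else a \<le> b \<and> exponent_le u v)"
| "exponent_le _ _ \<longleftrightarrow> False"

lemma exponent_le_length: "exponent_le u v \<Longrightarrow> length u = length v"
  by (induction u v rule: exponent_le.induct) (auto split: if_splits)

text \<open>Thin out the sequence until the heads are nondecreasing, then thin out the tails by
  induction. The bounded last entry is settled in the base case by the pigeonhole principle.\<close>

lemma dickson_subseq:
  assumes "\<And>k. length (f k) = Suc n" "\<And>k. last (f k) < s"
  shows "\<exists>g::nat\<Rightarrow>nat. strict_mono g \<and> (\<forall>k l. k \<le> l \<longrightarrow> exponent_le (f (g k)) (f (g l)))"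
  using assms
proof (induction n arbitrary: f)
  case 0
  have "finite (range (\<lambda>k. last (f k)))"
  proof (rule finite_subset)
    show "range (\<lambda>k. last (f k)) \<subseteq> {..<s}"
      using "0.prems"(2) by blast
  qed simp
  then obtain k0 where "infinite {k \<in> UNIV. last (f k) = last (f k0)}"
    using pigeonhole_infinite[of UNIV "\<lambda>k. last (f k)"] by blast
  then obtain c where A: "infinite {k. last (f k) = c}"
    by auto
  have "f k = [c]" if "last (f k) = c" for k
    using 0(1)[of k] that by (cases "f k") auto
  then have "f (enumerate {k. last (f k) = c} k) = [c]" for k
    using enumerate_in_set[OF A] by blast
  then have "\<forall>k l. k \<le> l \<longrightarrow> exponent_le (f (enumerate {k. last (f k) = c} k)) (f (enumerate {k. last (f k) = c} l))"
    by simp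
  then show ?case
    using strict_mono_enumerate[OF A] by blast
next
  case (Suc n)
  obtain g :: "nat \<Rightarrow> nat" where g: "strict_mono g" "mono ((\<lambda>k. hd (f k)) \<circ> g)"
    using mono_subseq_nat[of "\<lambda>k. hd (f k)"] .
  have f: "f k = hd (f k) # tl (f k)" and ne: "tl (f k) \<noteq> []" for k
    using Suc.prems(1)[of k] by (auto simp: length_Suc_conv)
  have "length (tl (f (g k))) = Suc n" "last (tl (f (g k))) < s" for k
    using Suc.prems(1)[of "g k"] Suc.prems(2)[of "g k"] ne[of "g k"] by (auto simp: last_tl)
  from Suc.IH[of "\<lambda>k. tl (f (g k))", OF this]
  obtain h :: "nat \<Rightarrow> nat" where h: "strict_mono h"
    "\<And>k l. k \<le> l \<Longrightarrow> exponent_le (tl (f (g (h k)))) (tl (f (g (h l))))"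
    by (elim exE conjE) simp
  have "exponent_le (f (g (h k))) (f (g (h l)))" if "k \<le> l" for k l
  proof -
    have "hd (f (g (h k))) \<le> hd (f (g (h l)))"
      using monoD[OF g(2) monoD[OF strict_mono_mono[OF h(1)] that]] by simp
    then have "exponent_le (hd (f (g (h k))) # tl (f (g (h k)))) (hd (f (g (h l))) # tl (f (g (h l))))"
      using h(2)[OF that] ne by simp
    then show ?thesis
      by (simp only: f[symmetric])
  qed
  then show ?case
    using strict_mono_compose[OF g(1) h(1)] by (intro exI[of _ "\<lambda>k. g (h k)"]) (auto simp: o_def)
qed

text \<open>If every step from \<open>i0\<close> on were strict, the elements lost at the successive
  steps would contain one that lies below a later one. The later one still belongs to the set that
  the earlier one has just left, against closure under smaller exponents. A single coincidence of
  neighbours is all that the division algorithm below uses.\<close>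

lemma dickson_dcc:
  assumes len: "\<And>i u. u \<in> I i \<Longrightarrow> length u = Suc n \<and> last u < s"
    and anti: "\<And>i. I (Suc i) \<subseteq> I i"
    and down: "\<And>i u v. \<lbrakk>i \<ge> i0; v \<in> I i; exponent_le u v\<rbrakk> \<Longrightarrow> u \<in> I i"
  obtains i where "i \<ge> i0" "I (Suc i) = (I i :: nat list set)"
proof (rule ccontr)
  assume "\<not> thesis"
  then have "\<forall>i. \<exists>u. u \<in> I (i + i0) - I (Suc (i + i0))"
    using anti that by (metis DiffI le_add2 subsetI subset_antisym)
  then obtain f where f: "\<And>i. f i \<in> I (i + i0)" "\<And>i. f i \<notin> I (Suc (i + i0))"
    by (metis DiffE)
  then obtain g :: "nat \<Rightarrow> nat" where g: "strict_mono g" "\<And>k l. k \<le> l \<Longrightarrow> exponent_le (f (g k)) (f (g l))"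
    using dickson_subseq[of f n s] len by meson
  have "Suc (g 0 + i0) \<le> g 1 + i0"
    using strict_monoD[OF g(1), of 0 1] by simp
  then have "f (g 1) \<in> I (Suc (g 0 + i0))"
    using f(1)[of "g 1"] lift_Suc_antimono_le[of I, OF anti] by blast
  then have "f (g 0) \<in> I (Suc (g 0 + i0))"
    using down[of "Suc (g 0 + i0)"] g(2)[of 0 1] by simp
  then show False
    using f(2) by blast
qed

section \<open>Subspaces over a subfield\<close>

locale subfield_module = module R M for R (structure) and M (structure) +
  fixes K
  assumes subfield: "subfield K R"
begin

abbreviation subspace :: "'c set \<Rightarrow> bool" where
  "subspace V \<equiv> submodule V (R\<lparr>carrier := K\<rparr>) M"

abbreviation span :: "'c set \<Rightarrow> 'c set" where
  "span \<equiv> subspace_span R K M"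

text \<open>Factors of dimension at most one are described without bases: any element outside
  \<open>S i\<close> generates \<open>S (Suc i)\<close> modulo \<open>S i\<close>. The sequence is
  infinite and finally constant, so that \<open>Suc i\<close> is always a legal index.\<close>

definition flag :: "'c set \<Rightarrow> (nat \<Rightarrow> 'c set) \<Rightarrow> nat \<Rightarrow> bool" where
  "flag V S n \<longleftrightarrow> (\<forall>i. subspace (S i) \<and> S i \<subseteq> S (Suc i)) \<and> S 0 = {\<zero>\<^bsub>M\<^esub>} \<and>
     (\<forall>i. \<forall>x\<in>S (Suc i). \<forall>z\<in>S (Suc i) - S i. \<exists>c\<in>K. x \<ominus>\<^bsub>M\<^esub> c \<odot>\<^bsub>M\<^esub> z \<in> S i) \<and>
     (\<forall>i\<ge>n. S i = V)"

lemma K_carrier [simp, intro]: "a \<in> K \<Longrightarrow> a \<in> carrier R"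
  using subfieldE(3)[OF subfield] by blast

lemmas K_closed = subringE[OF subfieldE(1)[OF subfield]]

lemma K_pow: "a \<in> K \<Longrightarrow> a [^] (n::nat) \<in> K"
  by (induction n) (auto simp: K_closed)

lemma K_inv: "a \<in> K \<Longrightarrow> a \<noteq> \<zero> \<Longrightarrow> inv a \<in> K \<and> inv a \<otimes> a = \<one>"
  using subfield_m_inv[OF subfield, of a] by blast

lemma module_K: "module (R\<lparr>carrier := K\<rparr>) M"
proof (rule moduleI)
  show "cring (R\<lparr>carrier := K\<rparr>)"
    using subfield_iff(2)[OF subfield] by (simp add: field_def domain_def)
qed (auto simp: smult_l_distr smult_r_distr smult_assoc1 intro: abelian_group_axioms M.abelian_group_axioms)

lemma subspaceI:
  assumes "V \<subseteq> carrier M" "\<zero>\<^bsub>M\<^esub> \<in> V" "\<And>a b. \<lbrakk>a \<in> V; b \<in> V\<rbrakk> \<Longrightarrow> a \<oplus>\<^bsub>M\<^esub> b \<in> V"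
    "\<And>a x. \<lbrakk>a \<in> K; x \<in> V\<rbrakk> \<Longrightarrow> a \<odot>\<^bsub>M\<^esub> x \<in> V"
  shows "subspace V"
proof (rule module.submoduleI[OF module_K])
  fix a assume a: "a \<in> V"
  have "(\<ominus> \<one>) \<odot>\<^bsub>M\<^esub> a \<in> V"
    using assms(4) a K_closed by simp
  then show "\<ominus>\<^bsub>M\<^esub> a \<in> V"
    using a assms(1) smult_l_minus[of \<one> a] by auto
qed (use assms in auto)

lemma subspaceD:
  assumes "subspace V"
  shows subspace_carrier: "V \<subseteq> carrier M"
    and subspace_zero: "\<zero>\<^bsub>M\<^esub> \<in> V"
    and subspace_add: "\<And>a b. \<lbrakk>a \<in> V; b \<in> V\<rbrakk> \<Longrightarrow> a \<oplus>\<^bsub>M\<^esub> b \<in> V"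
    and subspace_smult: "\<And>a x. \<lbrakk>a \<in> K; x \<in> V\<rbrakk> \<Longrightarrow> a \<odot>\<^bsub>M\<^esub> x \<in> V"
    and subspace_minus: "\<And>a b. \<lbrakk>a \<in> V; b \<in> V\<rbrakk> \<Longrightarrow> a \<ominus>\<^bsub>M\<^esub> b \<in> V"
proof -
  note E = module.submoduleE[OF module_K assms]
  show "V \<subseteq> carrier M" by (rule E(1))
  show add: "a \<oplus>\<^bsub>M\<^esub> b \<in> V" if "a \<in> V" "b \<in> V" for a b using E(5) that by blast
  show "a \<odot>\<^bsub>M\<^esub> x \<in> V" if "a \<in> K" "x \<in> V" for a x using E(4) that by simp
  show "a \<ominus>\<^bsub>M\<^esub> b \<in> V" if "a \<in> V" "b \<in> V" for a b
    using add E(3) that by (simp add: a_minus_def)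
  obtain a where "a \<in> V" using E(2) by blast
  then have "a \<oplus>\<^bsub>M\<^esub> (\<ominus>\<^bsub>M\<^esub> a) \<in> V" "a \<in> carrier M" using add E(3) E(1) by blast+
  then show "\<zero>\<^bsub>M\<^esub> \<in> V" by (simp add: M.r_neg)
qed

lemma subspace_carrier_M: "subspace (carrier M)"
  by (rule module.carrier_is_submodule[OF module_K])

lemma span_superset: "A \<subseteq> span A"
  by (auto simp: subspace_span_def)

lemma span_minimal: "subspace V \<Longrightarrow> A \<subseteq> V \<Longrightarrow> span A \<subseteq> V"
  by (auto simp: subspace_span_def)

lemma span_subspace:
  assumes "A \<subseteq> carrier M"
  shows "subspace (span A)"
proof (rule subspaceI)
  show "span A \<subseteq> carrier M"
    using span_minimal[OF subspace_carrier_M assms] .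
qed (auto simp: subspace_span_def subspaceD)

lemmas span_carrier = subspace_carrier[OF span_subspace]
  and span_zero = subspace_zero[OF span_subspace]
  and span_add = subspace_add[OF span_subspace]
  and span_smult = subspace_smult[OF span_subspace]
  and span_minus = subspace_minus[OF span_subspace]

lemma span_mono: "A \<subseteq> B \<Longrightarrow> span A \<subseteq> span B"
  by (auto simp: subspace_span_def)

lemma span_induct [consumes 2, case_names base zero add smult]:
  assumes "v \<in> span A" "A \<subseteq> carrier M"
    and "\<And>a. a \<in> A \<Longrightarrow> P a" "P \<zero>\<^bsub>M\<^esub>"
    and "\<And>u v. \<lbrakk>u \<in> span A; v \<in> span A; P u; P v\<rbrakk> \<Longrightarrow> P (u \<oplus>\<^bsub>M\<^esub> v)"
    and "\<And>a v. \<lbrakk>a \<in> K; v \<in> span A; P v\<rbrakk> \<Longrightarrow> P (a \<odot>\<^bsub>M\<^esub> v)"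
  shows "P v"
proof -
  have "subspace {v \<in> span A. P v}"
    using assms(2-) span_carrier[OF assms(2)]
    by (intro subspaceI) (auto intro: span_zero span_add span_smult)
  then have "span A \<subseteq> {v \<in> span A. P v}"
    using assms(2,3) span_superset[of A] by (intro span_minimal) auto
  then show ?thesis
    using assms(1) by blast
qed

lemma span_finite:
  assumes "v \<in> span A" "A \<subseteq> carrier M"
  shows "\<exists>B\<subseteq>A. finite B \<and> v \<in> span B"
  using assms
proof (induction rule: span_induct)
  case (base a)
  then show ?case using span_superset[of "{a}"] by (intro exI[of _ "{a}"]) auto
next
  case zero
  then show ?case using span_zero[of "{}"] by (intro exI[of _ "{}"]) auto
next
  case (add u v)
  then obtain B C where B: "B \<subseteq> A" "finite B" "u \<in> span B" and C: "C \<subseteq> A" "finite C" "v \<in> span C"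
    by blast
  have "u \<oplus>\<^bsub>M\<^esub> v \<in> span (B \<union> C)"
    using B C span_mono[of B "B \<union> C"] span_mono[of C "B \<union> C"] assms(2)
    by (intro span_add) auto
  then show ?case using B C by (intro exI[of _ "B \<union> C"]) auto
next
  case (smult a v)
  then show ?case using assms(2) by (meson span_smult subset_trans)
qed

lemma span_Un:
  assumes "v \<in> span (A \<union> B)" "A \<subseteq> carrier M" "B \<subseteq> carrier M"
  shows "\<exists>a\<in>span A. \<exists>b\<in>span B. v = a \<oplus>\<^bsub>M\<^esub> b"
proof -
  note [simp] = span_carrier[OF assms(2), THEN subsetD] span_carrier[OF assms(3), THEN subsetD]
  have "A \<union> B \<subseteq> carrier M" using assms by simp
  with assms(1) show ?thesis
  proof (induction rule: span_induct)
    case (base v)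
    then consider "v \<in> A" | "v \<in> B" by blast
    then show ?case
    proof cases
      case 1
      then show ?thesis using span_superset[of A] span_zero[OF assms(3)] assms(2)
        by (metis M.r_zero subsetD)
    next
      case 2
      then show ?thesis using span_superset[of B] span_zero[OF assms(2)] assms(3)
        by (metis M.l_zero subsetD)
    qed
  next
    case zero
    then show ?case using span_zero[OF assms(2)] span_zero[OF assms(3)] by (metis M.r_zero M.zero_closed)
  next
    case (add u v)
    then obtain a b c d where "a \<in> span A" "b \<in> span B" "u = a \<oplus>\<^bsub>M\<^esub> b"
      "c \<in> span A" "d \<in> span B" "v = c \<oplus>\<^bsub>M\<^esub> d" by blast
    moreover from this have "u \<oplus>\<^bsub>M\<^esub> v = (a \<oplus>\<^bsub>M\<^esub> c) \<oplus>\<^bsub>M\<^esub> (b \<oplus>\<^bsub>M\<^esub> d)"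
      by (simp add: M.a_ac)
    ultimately show ?case using span_add[OF assms(2)] span_add[OF assms(3)] by blast
  next
    case (smult k v)
    then obtain a b where "a \<in> span A" "b \<in> span B" "v = a \<oplus>\<^bsub>M\<^esub> b" by blast
    moreover from this have "k \<odot>\<^bsub>M\<^esub> v = k \<odot>\<^bsub>M\<^esub> a \<oplus>\<^bsub>M\<^esub> k \<odot>\<^bsub>M\<^esub> b"
      using smult by (simp add: smult_r_distr)
    ultimately show ?case using span_smult[OF assms(2)] span_smult[OF assms(3)] smult by blast
  qed
qed

end

section \<open>The lexicographic filtration\<close>

text \<open>The exponent \<open>a\<^sub>1 # \<dots> # a\<^sub>m # [i]\<close> collects the elements \<open>x\<close> that behave, with respect to the
  commuting operators \<open>r\<^sub>1, \<dots>, r\<^sub>m\<close>, like an inverse monomial bounded by \<open>r\<^sub>1 ^ (-a\<^sub>1) \<cdots> r\<^sub>m ^ (-a\<^sub>m)\<close>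
  with coefficient in \<open>T i\<close>.\<close>

fun lex_filtration ::
    "('a, 'b) ring_scheme \<Rightarrow> ('a, 'c, 'd) module_scheme \<Rightarrow> (nat \<Rightarrow> 'c set) \<Rightarrow> 'a list \<Rightarrow> nat list \<Rightarrow> 'c set"
  where
    "lex_filtration R M T [] [i] = T i"
  | "lex_filtration R M T (r # rs) (a # d) = {x \<in> carrier M. (r [^]\<^bsub>R\<^esub> Suc a) \<odot>\<^bsub>M\<^esub> x = \<zero>\<^bsub>M\<^esub> \<and>
       (r [^]\<^bsub>R\<^esub> a) \<odot>\<^bsub>M\<^esub> x \<in> lex_filtration R M T rs d}"
  | "lex_filtration R M T _ _ = {}"

context module
begin

lemma smult_comm:
  "\<lbrakk>a \<in> carrier R; b \<in> carrier R; x \<in> carrier M\<rbrakk> \<Longrightarrow> a \<odot>\<^bsub>M\<^esub> (b \<odot>\<^bsub>M\<^esub> x) = b \<odot>\<^bsub>M\<^esub> (a \<odot>\<^bsub>M\<^esub> x)"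
  by (metis smult_assoc1 R.m_comm)

lemma smult_minus:
  "\<lbrakk>a \<in> carrier R; x \<in> carrier M; y \<in> carrier M\<rbrakk> \<Longrightarrow>
    a \<odot>\<^bsub>M\<^esub> (x \<ominus>\<^bsub>M\<^esub> y) = a \<odot>\<^bsub>M\<^esub> x \<ominus>\<^bsub>M\<^esub> a \<odot>\<^bsub>M\<^esub> y"
  by (simp add: a_minus_def smult_r_distr smult_r_minus)

lemma pow_smult_zero_mono:
  fixes m n :: nat
  assumes "(r [^] m) \<odot>\<^bsub>M\<^esub> x = \<zero>\<^bsub>M\<^esub>" "m \<le> n" "r \<in> carrier R" "x \<in> carrier M"
  shows "(r [^] n) \<odot>\<^bsub>M\<^esub> x = \<zero>\<^bsub>M\<^esub>"
proof -
  have "r [^] n = r [^] (n - m) \<otimes> r [^] m"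
    using assms by (simp add: R.nat_pow_mult)
  then show ?thesis using assms by (simp add: smult_assoc1)
qed

end

text \<open>The recursion reads \<open>T\<close> only at the last entry of the exponent. Hence the
  two filtrations used below, built from \<open>S (Suc i)\<close> and from \<open>S i\<close>, agree
  wherever the flag does not grow.\<close>

lemma lex_filtration_cong:
  "T (last d) = T' (last d) \<Longrightarrow> lex_filtration R M T rs d = lex_filtration R M T' rs d"
proof (induction R M T rs d rule: lex_filtration.induct)
  case (2 R M T r rs a d)
  then show ?case by (cases "d = []"; cases rs) auto
qed auto

context subfield_module
begin

lemma lex_filtration_subspace:
  assumes "\<And>i. subspace (T i)" "set rs \<subseteq> carrier R" "length d = Suc (length rs)"
  shows "subspace (lex_filtration R M T rs d)"
  using assms(2,3)
proof (induction rs arbitrary: d)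
  case Nil
  then show ?case using assms(1) by (auto simp: length_Suc_conv)
next
  case (Cons r rs)
  then obtain a u where d: "d = a # u" "length u = Suc (length rs)"
    by (auto simp: length_Suc_conv)
  have S: "subspace (lex_filtration R M T rs u)" using Cons d by simp
  have r: "r \<in> carrier R" using Cons by simp
  show ?case unfolding d
    by (rule subspaceI)
      (use r S in \<open>auto simp: smult_r_distr subspaceD[OF S] smult_comm simp del: R.nat_pow_Suc\<close>)
qed

text \<open>\<open>\<rho>\<close> is the product of the powers of the operators by the differences
  of the two exponents. It does not depend on \<open>T\<close>, \<open>T'\<close> and
  \<open>x\<close>, so one multiplier serves both filtrations. If it is not \<open>\<one>\<close>,
  it is a multiple of an operator, which later makes it kill an orbit.\<close>

lemma lex_filtration_shift:
  assumes "set rs \<subseteq> carrier R" "length d = Suc (length rs)" "exponent_le d' d"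
  shows "\<exists>\<rho>\<in>carrier R. (\<rho> = \<one> \<or> (\<exists>r\<in>set rs. \<exists>s\<in>carrier R. \<rho> = s \<otimes> r)) \<and>
    (\<forall>T T' x. x \<in> carrier M \<longrightarrow> x \<in> lex_filtration R M T rs d \<longrightarrow>
      (\<rho> \<odot>\<^bsub>M\<^esub> x \<in> lex_filtration R M T' rs d' \<longleftrightarrow> x \<in> lex_filtration R M T' rs d))"
  using assms
proof (induction rs arbitrary: d d')
  case Nil
  then obtain i where "d = [i]" by (auto simp: length_Suc_conv)
  moreover from this Nil have "d' = [i]" by (cases d') (auto split: if_splits)
  ultimately show ?case by (intro bexI[of _ \<one>]) auto
next
  case (Cons r rs)
  from Cons.prems obtain a u where d: "d = a # u" "length u = Suc (length rs)"
    by (auto simp: length_Suc_conv)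
  then have "u \<noteq> []" by auto
  with Cons.prems(3) d obtain a' u' where d': "d' = a' # u'" "a' \<le> a" "exponent_le u' u"
    by (cases d') (auto split: if_splits)
  have r: "r \<in> carrier R" and rs: "set rs \<subseteq> carrier R" using Cons.prems by auto
  from Cons.IH[OF rs d(2) d'(3)] obtain \<sigma> where \<sigma>: "\<sigma> \<in> carrier R"
    "\<sigma> = \<one> \<or> (\<exists>r\<in>set rs. \<exists>s\<in>carrier R. \<sigma> = s \<otimes> r)"
    and iff: "\<And>T T' x. x \<in> carrier M \<Longrightarrow> x \<in> lex_filtration R M T rs u \<Longrightarrow>
      (\<sigma> \<odot>\<^bsub>M\<^esub> x \<in> lex_filtration R M T' rs u' \<longleftrightarrow> x \<in> lex_filtration R M T' rs u)"
    by blast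
  define b where "b = a - a'"
  have ab: "a = a' + b" using d'(2) by (simp add: b_def)
  define \<rho> where "\<rho> = \<sigma> \<otimes> r [^] b"
  have \<rho>: "\<rho> \<in> carrier R" using \<sigma> r by (simp add: \<rho>_def)
  have fact: "\<rho> = \<one> \<or> (\<exists>r\<in>set (r # rs). \<exists>s\<in>carrier R. \<rho> = s \<otimes> r)"
  proof (cases b)
    case 0
    then show ?thesis using \<sigma> by (auto simp: \<rho>_def)
  next
    case (Suc c)
    then have "\<rho> = (\<sigma> \<otimes> r [^] c) \<otimes> r" using \<sigma> r by (simp add: \<rho>_def R.m_assoc)
    then show ?thesis using \<sigma> r by auto
  qed
  \<comment> \<open>\<open>k = 1\<close> yields the vanishing condition at \<open>a'\<close>, and
    \<open>k = 0\<close> the top coefficient.\<close>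
  have pow: "(r [^] (a' + k)) \<odot>\<^bsub>M\<^esub> (\<rho> \<odot>\<^bsub>M\<^esub> x) = \<sigma> \<odot>\<^bsub>M\<^esub> ((r [^] (a + k)) \<odot>\<^bsub>M\<^esub> x)" if "x \<in> carrier M" for x k
  proof -
    have "r [^] (a' + k) \<otimes> \<rho> = \<sigma> \<otimes> r [^] (a + k)"
      using \<sigma> r by (simp add: \<rho>_def ab R.nat_pow_mult[symmetric] R.m_ac)
    then show ?thesis using that \<sigma> r \<rho> by (metis smult_assoc1 R.nat_pow_closed)
  qed
  have "\<rho> \<odot>\<^bsub>M\<^esub> x \<in> lex_filtration R M T' (r # rs) d' \<longleftrightarrow> x \<in> lex_filtration R M T' (r # rs) d"
    if x: "x \<in> carrier M" "x \<in> lex_filtration R M T (r # rs) d" for T T' x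
  proof -
    have 1: "(r [^] Suc a) \<odot>\<^bsub>M\<^esub> x = \<zero>\<^bsub>M\<^esub>" "(r [^] a) \<odot>\<^bsub>M\<^esub> x \<in> lex_filtration R M T rs u"
      using x(2) unfolding d by auto
    have 2: "(r [^] Suc a') \<odot>\<^bsub>M\<^esub> (\<rho> \<odot>\<^bsub>M\<^esub> x) = \<zero>\<^bsub>M\<^esub>"
      using pow[OF x(1), of 1] 1(1) \<sigma>(1) by simp
    have 3: "(r [^] a') \<odot>\<^bsub>M\<^esub> (\<rho> \<odot>\<^bsub>M\<^esub> x) = \<sigma> \<odot>\<^bsub>M\<^esub> ((r [^] a) \<odot>\<^bsub>M\<^esub> x)"
      using pow[OF x(1), of 0] by simp
    show ?thesis
      unfolding d d' lex_filtration.simps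
      using iff[OF _ 1(2), of T'] 1(1) 2 3 x(1) \<rho> r by simp
  qed
  then show ?case using \<rho> fact by blast
qed

end

section \<open>Injective Frobenius actions\<close>

locale frobenius_module = subfield_module +
  fixes p :: nat and F
  assumes p: "p \<ge> 2"
    and F_closed [simp, intro]: "x \<in> carrier M \<Longrightarrow> F x \<in> carrier M"
    and F_add: "\<lbrakk>x \<in> carrier M; y \<in> carrier M\<rbrakk> \<Longrightarrow> F (x \<oplus>\<^bsub>M\<^esub> y) = F x \<oplus>\<^bsub>M\<^esub> F y"
    and F_smult: "\<lbrakk>r \<in> carrier R; x \<in> carrier M\<rbrakk> \<Longrightarrow> F (r \<odot>\<^bsub>M\<^esub> x) = (r [^] p) \<odot>\<^bsub>M\<^esub> F x"
    and F_inj: "inj_on F (carrier M)"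
begin

lemma funpow_closed [simp, intro]: "x \<in> carrier M \<Longrightarrow> (F ^^ j) x \<in> carrier M"
  by (induction j) auto

lemma funpow_add: "\<lbrakk>x \<in> carrier M; y \<in> carrier M\<rbrakk> \<Longrightarrow> (F ^^ j) (x \<oplus>\<^bsub>M\<^esub> y) = (F ^^ j) x \<oplus>\<^bsub>M\<^esub> (F ^^ j) y"
  by (induction j) (auto simp: F_add)

lemma funpow_smult:
  "\<lbrakk>r \<in> carrier R; x \<in> carrier M\<rbrakk> \<Longrightarrow> (F ^^ j) (r \<odot>\<^bsub>M\<^esub> x) = (r [^] (p ^ j)) \<odot>\<^bsub>M\<^esub> (F ^^ j) x"
proof (induction j)
  case (Suc j)
  then show ?case by (simp add: F_smult R.nat_pow_pow mult.commute)
qed auto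

lemma funpow_zero [simp]: "(F ^^ j) \<zero>\<^bsub>M\<^esub> = \<zero>\<^bsub>M\<^esub>"
  using funpow_smult[of \<zero> "\<zero>\<^bsub>M\<^esub>" j] p by (simp add: R.nat_pow_zero)

lemma funpow_eq_zero: "\<lbrakk>(F ^^ j) x = \<zero>\<^bsub>M\<^esub>; x \<in> carrier M\<rbrakk> \<Longrightarrow> x = \<zero>\<^bsub>M\<^esub>"
proof (induction j)
  case (Suc j)
  have "F ((F ^^ j) x) = F \<zero>\<^bsub>M\<^esub>"
    using Suc.prems(1) funpow_zero[of 1] by simp
  then have "(F ^^ j) x = \<zero>\<^bsub>M\<^esub>"
    using F_inj Suc.prems(2) by (auto dest: inj_onD)
  then show ?case using Suc by blast
qed auto

lemma funpow_funpow: "(F ^^ i) ((F ^^ j) x) = (F ^^ (i + j)) x"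
  by (simp add: Nat.funpow_add)

text \<open>\<open>F ^^ j\<close> is semilinear: a scalar comes out as its \<open>p ^ j\<close>-th
  power, which is again in \<open>K\<close>.\<close>

lemma funpow_span:
  assumes "v \<in> span A" "A \<subseteq> carrier M"
  shows "(F ^^ j) v \<in> span ((F ^^ j) ` A)"
proof -
  have A: "(F ^^ j) ` A \<subseteq> carrier M" using assms(2) by auto
  note [simp] = span_carrier[OF assms(2), THEN subsetD]
  show ?thesis
    using assms
  proof (induction rule: span_induct)
    case (base a)
    then show ?case using span_superset by blast
  next
    case zero
    then show ?case using span_zero[OF A] by simp
  next
    case (add u v)
    then show ?case using span_add[OF A] by (simp add: funpow_add)
  next
    case (smult a v)
    then show ?case using span_smult[OF A] K_pow by (simp add: funpow_smult)
  qed
qed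

end

text \<open>In the application \<open>rs\<close> lists generators of the maximal ideal, so the
  common annihilator in \<open>flag_socle\<close> is the socle. The ideal is thereby replaced by
  finitely many commuting torsion operators.\<close>

locale filtered_frobenius_module = frobenius_module +
  fixes rs :: "'a list" and S :: "nat \<Rightarrow> 'c set" and n :: nat
  assumes rs_carrier: "set rs \<subseteq> carrier R"
    and torsion: "\<lbrakk>r \<in> set rs; x \<in> carrier M\<rbrakk> \<Longrightarrow> \<exists>k::nat. (r [^] k) \<odot>\<^bsub>M\<^esub> x = \<zero>\<^bsub>M\<^esub>"
    and flag_socle: "flag {x \<in> carrier M. \<forall>r\<in>set rs. r \<odot>\<^bsub>M\<^esub> x = \<zero>\<^bsub>M\<^esub>} S n"
begin

lemma
  shows S_subspace: "subspace (S i)"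
    and S_0: "S 0 = {\<zero>\<^bsub>M\<^esub>}"
    and S_step: "\<lbrakk>x \<in> S (Suc i); z \<in> S (Suc i); z \<notin> S i\<rbrakk> \<Longrightarrow> \<exists>c\<in>K. x \<ominus>\<^bsub>M\<^esub> c \<odot>\<^bsub>M\<^esub> z \<in> S i"
    and S_top: "i \<ge> n \<Longrightarrow> S i = {x \<in> carrier M. \<forall>r\<in>set rs. r \<odot>\<^bsub>M\<^esub> x = \<zero>\<^bsub>M\<^esub>}"
  using flag_socle by (simp_all add: flag_def)

text \<open>Both are indexed by the same exponent: \<open>filt rs d / sfilt rs d\<close> is the factor at \<open>d\<close>.\<close>

abbreviation filt where "filt \<equiv> lex_filtration R M (\<lambda>i. S (Suc i))"
abbreviation sfilt where "sfilt \<equiv> lex_filtration R M S"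

lemma torsion_uniform:
  assumes "r \<in> set rs" "finite A" "A \<subseteq> carrier M"
  shows "\<exists>k::nat. \<forall>x\<in>A. (r [^] k) \<odot>\<^bsub>M\<^esub> x = \<zero>\<^bsub>M\<^esub>"
  using assms(2,3)
proof (induction A)
  case (insert x A)
  have r: "r \<in> carrier R" using assms(1) rs_carrier by blast
  obtain k :: nat where k: "\<forall>x\<in>A. (r [^] k) \<odot>\<^bsub>M\<^esub> x = \<zero>\<^bsub>M\<^esub>" using insert by auto
  obtain l :: nat where l: "(r [^] l) \<odot>\<^bsub>M\<^esub> x = \<zero>\<^bsub>M\<^esub>" using torsion[OF assms(1), of x] insert by auto
  have "(r [^] max k l) \<odot>\<^bsub>M\<^esub> y = \<zero>\<^bsub>M\<^esub>" if "y \<in> insert x A" for y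
    using that k l insert.prems r pow_smult_zero_mono[of r k y "max k l"] pow_smult_zero_mono[of r l y "max k l"]
    by (auto dest: subsetD)
  then show ?case by blast
qed auto

section \<open>Factors and exhaustion of the lexicographic filtration\<close>

lemma filt_subspace:
  assumes "set us \<subseteq> set rs" "length d = Suc (length us)"
  shows "subspace (filt us d)" "subspace (sfilt us d)"
  using assms rs_carrier S_subspace by (intro lex_filtration_subspace; force)+

text \<open>Multiplication by \<open>r [^] a\<close> embeds the factor at \<open>a # u\<close> into
  the factor at \<open>u\<close>; at the end of the list the factor is one of the flag.\<close>

lemma filt_diff:
  assumes "set us \<subseteq> set rs" "length d = Suc (length us)"
    "x \<in> filt us d" "z \<in> filt us d" "z \<notin> sfilt us d"
  shows "\<exists>c\<in>K. x \<ominus>\<^bsub>M\<^esub> c \<odot>\<^bsub>M\<^esub> z \<in> sfilt us d"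
  using assms
proof (induction us arbitrary: d x z)
  case Nil
  then show ?case using S_step by (auto simp: length_Suc_conv)
next
  case (Cons r us)
  then obtain a u where d: "d = a # u" "length u = Suc (length us)"
    by (auto simp: length_Suc_conv)
  have r: "r \<in> carrier R" using Cons.prems(1) rs_carrier by auto
  from Cons.prems(3,4,5) have x: "x \<in> carrier M" "z \<in> carrier M"
    "(r [^] Suc a) \<odot>\<^bsub>M\<^esub> x = \<zero>\<^bsub>M\<^esub>" "(r [^] Suc a) \<odot>\<^bsub>M\<^esub> z = \<zero>\<^bsub>M\<^esub>"
    "(r [^] a) \<odot>\<^bsub>M\<^esub> x \<in> filt us u" "(r [^] a) \<odot>\<^bsub>M\<^esub> z \<in> filt us u"
    "(r [^] a) \<odot>\<^bsub>M\<^esub> z \<notin> sfilt us u"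
    unfolding d lex_filtration.simps by blast+
  obtain c where c: "c \<in> K" "(r [^] a) \<odot>\<^bsub>M\<^esub> x \<ominus>\<^bsub>M\<^esub> c \<odot>\<^bsub>M\<^esub> ((r [^] a) \<odot>\<^bsub>M\<^esub> z) \<in> sfilt us u"
    using Cons.IH[OF _ d(2) x(5-7)] Cons.prems(1) by auto
  have "(r [^] Suc a) \<odot>\<^bsub>M\<^esub> (x \<ominus>\<^bsub>M\<^esub> c \<odot>\<^bsub>M\<^esub> z) = \<zero>\<^bsub>M\<^esub>"
  proof -
    have q: "r [^] Suc a \<in> carrier R" using r by simp
    show ?thesis
      using smult_minus[OF q x(1), of "c \<odot>\<^bsub>M\<^esub> z"] smult_comm[OF q, of c z] x(1-4) c(1)
      by (simp add: a_minus_def M.r_neg del: R.nat_pow_Suc)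
  qed
  moreover have "(r [^] a) \<odot>\<^bsub>M\<^esub> (x \<ominus>\<^bsub>M\<^esub> c \<odot>\<^bsub>M\<^esub> z) \<in> sfilt us u"
    using c x(1,2) r smult_comm[of "r [^] a" c z] by (simp add: smult_minus)
  ultimately have "x \<ominus>\<^bsub>M\<^esub> c \<odot>\<^bsub>M\<^esub> z \<in> sfilt (r # us) d"
    using x(1,2) c(1) unfolding d lex_filtration.simps by simp
  then show ?case using c(1) by blast
qed

text \<open>By torsion, one power of each operator annihilates the whole finite set. The condition
  on operators outside \<open>us\<close> puts the elements into the top of the flag once the list is
  exhausted.\<close>

lemma filt_cover:
  assumes "set us \<subseteq> set rs" "finite A" "A \<subseteq> carrier M"
    "\<And>x r. \<lbrakk>x \<in> A; r \<in> set rs - set us\<rbrakk> \<Longrightarrow> r \<odot>\<^bsub>M\<^esub> x = \<zero>\<^bsub>M\<^esub>"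
  shows "\<exists>d. length d = Suc (length us) \<and> A \<subseteq> filt us d"
  using assms
proof (induction us arbitrary: A)
  case Nil
  then have "A \<subseteq> S (Suc n)" using S_top[of "Suc n"] by auto
  then show ?case by (intro exI[of _ "[n]"]) auto
next
  case (Cons r us)
  have r: "r \<in> set rs" "r \<in> carrier R" using Cons.prems(1) rs_carrier by auto
  obtain a :: nat where a: "\<forall>x\<in>A. (r [^] a) \<odot>\<^bsub>M\<^esub> x = \<zero>\<^bsub>M\<^esub>"
    using torsion_uniform[OF r(1) Cons.prems(2,3)] by blast
  have a': "(r [^] Suc a) \<odot>\<^bsub>M\<^esub> x = \<zero>\<^bsub>M\<^esub>" if "x \<in> A" for x
    using a that Cons.prems(3) r pow_smult_zero_mono[of r a x "Suc a"] by auto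
  let ?B = "(\<lambda>x. (r [^] a) \<odot>\<^bsub>M\<^esub> x) ` A"
  \<comment> \<open>\<open>a\<close> was chosen so that all top coefficients vanish; the induction
    hypothesis only has to deliver some tail of the right length.\<close>
  have B: "?B \<subseteq> {\<zero>\<^bsub>M\<^esub>}" using a by auto
  have "\<exists>u. length u = Suc (length us) \<and> ?B \<subseteq> filt us u"
  proof (rule Cons.IH)
    show "s \<odot>\<^bsub>M\<^esub> y = \<zero>\<^bsub>M\<^esub>" if "y \<in> ?B" "s \<in> set rs - set us" for y s
      using subsetD[OF B that(1)] that(2) rs_carrier by auto
  qed (use B Cons.prems(1,2) in auto)
  then obtain u where u: "length u = Suc (length us)" "?B \<subseteq> filt us u"
    by blast
  then have "A \<subseteq> filt (r # us) (a # u)"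
    using a' Cons.prems(3) by auto
  then show ?case using u(1) by (intro exI[of _ "a # u"]) auto
qed

text \<open>This drives the well-founded induction of the division algorithm. An exponent such as
  \<open>[1, 0, 0]\<close> has no immediate predecessor, hence the restriction to finite sets.
  Either the tail can be lowered under the same head, or all top coefficients vanish and the head
  drops by one, with a fresh tail from \<open>filt_cover\<close>.\<close>

lemma sfilt_cover:
  assumes "set us \<subseteq> set rs" "length d = Suc (length us)" "finite A" "A \<subseteq> sfilt us d"
    "\<And>x r. \<lbrakk>x \<in> A; r \<in> set rs - set us\<rbrakk> \<Longrightarrow> r \<odot>\<^bsub>M\<^esub> x = \<zero>\<^bsub>M\<^esub>"
  shows "A \<subseteq> {\<zero>\<^bsub>M\<^esub>} \<or> (\<exists>d'. (d', d) \<in> lex less_than \<and> A \<subseteq> filt us d')"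
  using assms
proof (induction us arbitrary: A d)
  case Nil
  then obtain i where d: "d = [i]" by (auto simp: length_Suc_conv)
  show ?case
  proof (cases i)
    case 0
    then show ?thesis using Nil d S_0 by simp
  next
    case (Suc j)
    then show ?thesis using Nil d by (intro disjI2 exI[of _ "[j]"]) auto
  qed
next
  case (Cons r us)
  then obtain a u where d: "d = a # u" "length u = Suc (length us)"
    by (auto simp: length_Suc_conv)
  have r: "r \<in> set rs" "r \<in> carrier R" "set us \<subseteq> set rs" using Cons.prems(1) rs_carrier by auto
  have A: "x \<in> carrier M" "(r [^] Suc a) \<odot>\<^bsub>M\<^esub> x = \<zero>\<^bsub>M\<^esub>" "(r [^] a) \<odot>\<^bsub>M\<^esub> x \<in> sfilt us u" if "x \<in> A" for x
    using Cons.prems(4) that unfolding d lex_filtration.simps by blast+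
  \<comment> \<open>The condition on operators outside the list must pass to the tail, where
    \<open>r\<close> itself is such an operator; it kills \<open>(r [^] b) x\<close> because
    \<open>r [^] Suc b\<close> kills \<open>x\<close>.\<close>
  have kill: "s \<odot>\<^bsub>M\<^esub> ((r [^] b) \<odot>\<^bsub>M\<^esub> x) = \<zero>\<^bsub>M\<^esub>"
    if x: "x \<in> A" and s: "s \<in> set rs - set us" and b: "(r [^] Suc b) \<odot>\<^bsub>M\<^esub> x = \<zero>\<^bsub>M\<^esub>" for x s b
  proof (cases "s = r")
    case True
    then show ?thesis using b x A(1)[OF x] r by (simp add: smult_assoc1[symmetric] R.m_comm)
  next
    case False
    then show ?thesis using Cons.prems(5)[OF x, of s] s A(1)[OF x] r rs_carrier
      by (subst smult_comm) auto
  qed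
  let ?B = "(\<lambda>x. (r [^] a) \<odot>\<^bsub>M\<^esub> x) ` A"
  have "?B \<subseteq> {\<zero>\<^bsub>M\<^esub>} \<or> (\<exists>d'. (d', u) \<in> lex less_than \<and> ?B \<subseteq> filt us d')"
  proof (rule Cons.IH[OF r(3) d(2)])
    show "s \<odot>\<^bsub>M\<^esub> y = \<zero>\<^bsub>M\<^esub>" if "y \<in> ?B" "s \<in> set rs - set us" for y s
      using that kill A(2) by blast
  qed (use A Cons.prems(3) in auto)
  then show ?case
  proof (elim disjE exE conjE)
    fix d' assume d': "(d', u) \<in> lex less_than" "?B \<subseteq> filt us d'"
    then have "A \<subseteq> filt (r # us) (a # d')"
      using A by auto
    then show ?case using d' unfolding d by (intro disjI2 exI[of _ "a # d'"]) simp
  next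
    assume zero: "?B \<subseteq> {\<zero>\<^bsub>M\<^esub>}"
    show ?case
    proof (cases a)
      case 0
      then show ?thesis using zero A(1) by auto
    next
      case (Suc b)
      let ?C = "(\<lambda>x. (r [^] b) \<odot>\<^bsub>M\<^esub> x) ` A"
      have zb: "(r [^] Suc b) \<odot>\<^bsub>M\<^esub> x = \<zero>\<^bsub>M\<^esub>" if "x \<in> A" for x
        using zero that Suc by blast
      have "\<exists>u'. length u' = Suc (length us) \<and> ?C \<subseteq> filt us u'"
      proof (rule filt_cover[OF r(3)])
        show "s \<odot>\<^bsub>M\<^esub> y = \<zero>\<^bsub>M\<^esub>" if "y \<in> ?C" "s \<in> set rs - set us" for y s
          using that kill zb by blast
        show "?C \<subseteq> carrier M" using A(1) r(2) by (auto simp del: R.nat_pow_Suc)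
      qed (simp add: Cons.prems(3))
      then obtain u' where u': "length u' = Suc (length us)" "?C \<subseteq> filt us u'"
        by blast
      then have "A \<subseteq> filt (r # us) (b # u')"
        using A(1) zb by auto
      then show ?thesis
        using u'(1) d(2) unfolding d(1) Suc by (intro disjI2 exI[of _ "b # u'"]) simp
    qed
  qed
qed

text \<open>From index \<open>n\<close> on the flag is constant and the factor vanishes. This is the
  bound on last entries that Dickson's lemma asks for.\<close>

lemma filt_last:
  assumes "z \<in> filt us d" "z \<notin> sfilt us d"
  shows "last d < n"
proof (rule ccontr)
  assume "\<not> last d < n"
  then have "S (Suc (last d)) = S (last d)"
    using S_top[of "last d"] S_top[of "Suc (last d)"] by simp
  then have "filt us d = sfilt us d"
    by (intro lex_filtration_cong)
  then show False using assms by blast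
qed

section \<open>Leading exponents\<close>

definition orbit :: "'c \<Rightarrow> nat \<Rightarrow> nat \<Rightarrow> 'c set" where
  "orbit x i j = {(F ^^ a) x |a. a + i \<le> j}"

text \<open>After applying \<open>F\<^sup>-\<^sup>j\<close>, the set \<open>orbit x i j\<close> becomes \<open>{F\<^sup>-\<^sup>b x | i \<le> b \<le> j}\<close>, and the
  membership below says that \<open>z\<close> is the leading term of an element of its span over the perfect
  closure of \<open>K\<close>.\<close>

definition leading_exponents :: "'c \<Rightarrow> nat \<Rightarrow> nat list set" where
  "leading_exponents x i = {d. length d = Suc (length rs) \<and>
     (\<exists>z\<in>filt rs d - sfilt rs d. \<exists>j\<ge>i. (F ^^ j) z \<in> span ((F ^^ j) ` sfilt rs d \<union> orbit x i j))}"

lemma orbit_carrier: "x \<in> carrier M \<Longrightarrow> orbit x i j \<subseteq> carrier M"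
  by (auto simp: orbit_def)

lemma orbit_Suc_subset: "orbit x (Suc i) j \<subseteq> orbit x i j"
  by (force simp: orbit_def)

lemma funpow_orbit: "(F ^^ k) ` orbit x i j \<subseteq> orbit x i (j + k)"
  by (force simp: orbit_def funpow_funpow)

lemma funpow_image: "(F ^^ k) ` ((F ^^ j) ` A) = (F ^^ (j + k)) ` A"
  by (simp add: image_image funpow_funpow add.commute)

lemma funpow_span_orbit:
  assumes "v \<in> span (orbit x i j)" "x \<in> carrier M"
  shows "(F ^^ k) v \<in> span (orbit x i (j + k))"
  using funpow_span[OF assms(1) orbit_carrier[OF assms(2)], of k] span_mono[OF funpow_orbit] by blast

lemma funpow_minus:
  assumes "x \<in> carrier M" "y \<in> carrier M"
  shows "(F ^^ j) (x \<ominus>\<^bsub>M\<^esub> y) = (F ^^ j) x \<ominus>\<^bsub>M\<^esub> (F ^^ j) y"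
proof -
  have "(F ^^ j) (x \<ominus>\<^bsub>M\<^esub> y) \<oplus>\<^bsub>M\<^esub> (F ^^ j) y = (F ^^ j) x"
    using assms funpow_add[of "x \<ominus>\<^bsub>M\<^esub> y" y j] by (simp add: a_minus_def M.a_assoc M.l_neg)
  then show ?thesis
    using assms by (metis M.add.inv_solve_right M.minus_closed a_minus_def funpow_closed)
qed

lemma filt_carrier:
  assumes "length d = Suc (length rs)"
  shows "filt rs d \<subseteq> carrier M" "sfilt rs d \<subseteq> carrier M"
  using filt_subspace[OF subset_refl assms] subspace_carrier by auto

lemma leading_exponents_Suc: "x \<in> carrier M \<Longrightarrow> leading_exponents x (Suc i) \<subseteq> leading_exponents x i"
proof
  fix d assume x: "x \<in> carrier M" and "d \<in> leading_exponents x (Suc i)"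
  then obtain z j where "length d = Suc (length rs)" "z \<in> filt rs d - sfilt rs d" "j \<ge> Suc i"
    "(F ^^ j) z \<in> span ((F ^^ j) ` sfilt rs d \<union> orbit x (Suc i) j)"
    by (auto simp: leading_exponents_def)
  moreover have "span ((F ^^ j) ` sfilt rs d \<union> orbit x (Suc i) j) \<subseteq> span ((F ^^ j) ` sfilt rs d \<union> orbit x i j)"
    using orbit_Suc_subset by (intro span_mono) blast
  ultimately show "d \<in> leading_exponents x i"
    unfolding leading_exponents_def by (blast dest: Suc_leD)
qed

text \<open>Multiply the leading term by the \<open>\<rho>\<close> of
  \<open>lex_filtration_shift\<close>. Past \<open>F ^^ j\<close> it becomes \<open>q\<close>, which
  carries the lower layer at \<open>v\<close> into the one at \<open>u\<close> and either fixes the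
  orbit elements (\<open>\<rho> = \<one>\<close>) or kills them.\<close>

lemma leading_exponents_down:
  assumes x: "x \<in> carrier M" and i0: "\<And>r. r \<in> set rs \<Longrightarrow> (r [^] (p ^ i0)) \<odot>\<^bsub>M\<^esub> x = \<zero>\<^bsub>M\<^esub>"
    and i: "i \<ge> i0" and v: "v \<in> leading_exponents x i" and le: "exponent_le u v"
  shows "u \<in> leading_exponents x i"
proof -
  obtain z j where v_len: "length v = Suc (length rs)" and z: "z \<in> filt rs v" "z \<notin> sfilt rs v" and j: "j \<ge> i"
    and Fz: "(F ^^ j) z \<in> span ((F ^^ j) ` sfilt rs v \<union> orbit x i j)"
    using v by (auto simp: leading_exponents_def)
  have u_len: "length u = Suc (length rs)"
    using exponent_le_length[OF le] v_len by simp
  obtain \<rho> where \<rho>: "\<rho> \<in> carrier R" "\<rho> = \<one> \<or> (\<exists>r\<in>set rs. \<exists>s\<in>carrier R. \<rho> = s \<otimes> r)"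
    and shift: "\<And>T T' y. \<lbrakk>y \<in> carrier M; y \<in> lex_filtration R M T rs v\<rbrakk> \<Longrightarrow>
      \<rho> \<odot>\<^bsub>M\<^esub> y \<in> lex_filtration R M T' rs u \<longleftrightarrow> y \<in> lex_filtration R M T' rs v"
    using lex_filtration_shift[OF rs_carrier v_len le] by blast
  have zM: "z \<in> carrier M" using z filt_carrier[OF v_len] by blast
  have \<rho>z: "\<rho> \<odot>\<^bsub>M\<^esub> z \<in> filt rs u - sfilt rs u"
    using shift[OF zM z(1)] z by blast
  let ?A = "(F ^^ j) ` sfilt rs v \<union> orbit x i j" and ?B = "(F ^^ j) ` sfilt rs u \<union> orbit x i j"
  define q where "q = \<rho> [^] (p ^ j)"
  have q: "q \<in> carrier R" using \<rho>(1) by (simp add: q_def)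
  have A: "?A \<subseteq> carrier M" and B: "?B \<subseteq> carrier M"
    using filt_carrier[OF v_len] filt_carrier[OF u_len] orbit_carrier[OF x] by auto
  have kill: "q \<odot>\<^bsub>M\<^esub> y \<in> span ?B" if y: "y \<in> orbit x i j" for y
    using \<rho>(2)
  proof (elim disjE bexE)
    assume "\<rho> = \<one>"
    then have "q \<odot>\<^bsub>M\<^esub> y = y" using y orbit_carrier[OF x, of i j] by (auto simp: q_def)
    then show ?thesis using y span_superset[of ?B] by auto
  next
    fix r s assume r: "r \<in> set rs" and s: "s \<in> carrier R" and \<rho>_eq: "\<rho> = s \<otimes> r"
    have rR: "r \<in> carrier R" using r rs_carrier by blast
    obtain a where a: "y = (F ^^ a) x" "a + i \<le> j" using y by (auto simp: orbit_def)
    \<comment> \<open>The bound \<open>a + i \<le> j\<close> in the orbit gives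
      \<open>j - a \<ge> i0\<close>. So a power of \<open>r\<close> that kills \<open>x\<close>
      becomes, under \<open>F ^^ a\<close>, exactly the power \<open>p ^ j\<close>.\<close>
    have "p ^ i0 \<le> p ^ (j - a)" using a(2) i p by (intro power_increasing) auto
    then have "(r [^] (p ^ (j - a))) \<odot>\<^bsub>M\<^esub> x = \<zero>\<^bsub>M\<^esub>"
      using pow_smult_zero_mono[OF i0[OF r]] rR x by blast
    then have "(F ^^ a) ((r [^] (p ^ (j - a))) \<odot>\<^bsub>M\<^esub> x) = \<zero>\<^bsub>M\<^esub>"
      by simp
    then have "(r [^] (p ^ j)) \<odot>\<^bsub>M\<^esub> y = \<zero>\<^bsub>M\<^esub>"
      using a rR x by (simp add: funpow_smult R.nat_pow_pow power_add[symmetric])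
    moreover have "q = s [^] (p ^ j) \<otimes> r [^] (p ^ j)"
      using s rR by (simp add: q_def \<rho>_eq R.nat_pow_distrib)
    ultimately have "q \<odot>\<^bsub>M\<^esub> y = \<zero>\<^bsub>M\<^esub>"
      using s rR x a(1) by (simp add: smult_assoc1)
    then show ?thesis using span_zero[OF B] by simp
  qed
  have "q \<odot>\<^bsub>M\<^esub> w \<in> span ?B" if "w \<in> span ?A" for w
    using that A
  proof (induction rule: span_induct)
    case (base a)
    then show ?case
    proof
      assume "a \<in> (F ^^ j) ` sfilt rs v"
      then obtain s where s: "s \<in> sfilt rs v" "a = (F ^^ j) s" by blast
      have sM: "s \<in> carrier M" using s filt_carrier[OF v_len] by blast
      have "\<rho> \<odot>\<^bsub>M\<^esub> s \<in> sfilt rs u" using shift[OF sM s(1)] s(1) by blast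
      moreover have "q \<odot>\<^bsub>M\<^esub> a = (F ^^ j) (\<rho> \<odot>\<^bsub>M\<^esub> s)"
        using \<rho>(1) sM s(2) by (simp add: funpow_smult q_def)
      ultimately show ?thesis using span_superset[of ?B] by blast
    qed (rule kill)
  next
    case zero
    then show ?case using q span_zero[OF B] by simp
  next
    case (add w w')
    then show ?case using q span_add[OF B] span_carrier[OF A, THEN subsetD] by (simp add: smult_r_distr)
  next
    case (smult c w)
    then show ?case using q span_smult[OF B] span_carrier[OF A, THEN subsetD] smult_comm[OF q, of c w] by simp
  qed
  then have "(F ^^ j) (\<rho> \<odot>\<^bsub>M\<^esub> z) \<in> span ?B"
    using Fz \<rho>(1) zM by (simp add: funpow_smult q_def)
  then show ?thesis
    using u_len \<rho>z j unfolding leading_exponents_def by blast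
qed

lemma leading_exponents_stable:
  assumes x: "x \<in> carrier M"
  obtains i where "leading_exponents x (Suc i) = leading_exponents x i"
proof -
  have "\<exists>k. \<forall>r\<in>set us. (r [^] (k::nat)) \<odot>\<^bsub>M\<^esub> x = \<zero>\<^bsub>M\<^esub>" if "set us \<subseteq> set rs" for us
    using that
  proof (induction us)
    case (Cons r us)
    then obtain k :: nat where k: "\<forall>r\<in>set us. (r [^] k) \<odot>\<^bsub>M\<^esub> x = \<zero>\<^bsub>M\<^esub>" by auto
    obtain l :: nat where l: "(r [^] l) \<odot>\<^bsub>M\<^esub> x = \<zero>\<^bsub>M\<^esub>" using torsion[of r x] Cons.prems x by auto
    have "\<forall>s\<in>set (r # us). (s [^] max k l) \<odot>\<^bsub>M\<^esub> x = \<zero>\<^bsub>M\<^esub>"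
      using k l x Cons.prems rs_carrier pow_smult_zero_mono[of _ k x "max k l"] pow_smult_zero_mono[of _ l x "max k l"]
      by auto
    then show ?case by blast
  qed auto
  then obtain k :: nat where k: "\<And>r. r \<in> set rs \<Longrightarrow> (r [^] k) \<odot>\<^bsub>M\<^esub> x = \<zero>\<^bsub>M\<^esub>" by blast
  \<comment> \<open>Thus \<open>k\<close> itself can serve as the threshold from which the sets are
    closed under smaller exponents.\<close>
  have "k \<le> p ^ k" using p self_le_ge2_pow by blast
  then have k': "(r [^] (p ^ k)) \<odot>\<^bsub>M\<^esub> x = \<zero>\<^bsub>M\<^esub>" if "r \<in> set rs" for r
    using pow_smult_zero_mono[OF k[OF that]] that rs_carrier x by blast
  show thesis
  proof (rule dickson_dcc[of "leading_exponents x" "length rs" n k])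
    show "length u = Suc (length rs) \<and> last u < n" if "u \<in> leading_exponents x i" for i u
      using that filt_last by (auto simp: leading_exponents_def)
    show "leading_exponents x (Suc i) \<subseteq> leading_exponents x i" for i
      by (rule leading_exponents_Suc[OF x])
    show "u \<in> leading_exponents x i" if "k \<le> i" "v \<in> leading_exponents x i" "exponent_le u v" for i u v
      using leading_exponents_down[OF x k'] that by blast
  qed (use that in blast)
qed

text \<open>The factor still has dimension at most one after applying \<open>F ^^ j\<close> and
  taking spans: the scalar from \<open>filt_diff\<close> turns into its \<open>p ^ j\<close>-th
  power, and the relation extends linearly.\<close>

lemma span_filt_decompose:
  assumes d: "length d = Suc (length rs)" and z: "z \<in> filt rs d" "z \<notin> sfilt rs d"
    and w: "w \<in> span ((F ^^ j) ` filt rs d)"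
  shows "\<exists>c\<in>K. w \<ominus>\<^bsub>M\<^esub> c \<odot>\<^bsub>M\<^esub> (F ^^ j) z \<in> span ((F ^^ j) ` sfilt rs d)"
proof -
  let ?B = "(F ^^ j) ` sfilt rs d"
  have A: "(F ^^ j) ` filt rs d \<subseteq> carrier M" and B: "?B \<subseteq> carrier M"
    using filt_carrier[OF d] by auto
  have zM: "(F ^^ j) z \<in> carrier M" "z \<in> carrier M" using z filt_carrier[OF d] by auto
  note [simp] = span_carrier[OF A, THEN subsetD] zM
  show ?thesis
    using w A
  proof (induction rule: span_induct)
    case (base a)
    then obtain y where y: "y \<in> filt rs d" "a = (F ^^ j) y" by blast
    then obtain c where c: "c \<in> K" "y \<ominus>\<^bsub>M\<^esub> c \<odot>\<^bsub>M\<^esub> z \<in> sfilt rs d"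
      using filt_diff[OF subset_refl d _ z] by blast
    have yM: "y \<in> carrier M" using y filt_carrier[OF d] by blast
    have "(F ^^ j) (y \<ominus>\<^bsub>M\<^esub> c \<odot>\<^bsub>M\<^esub> z) = a \<ominus>\<^bsub>M\<^esub> (c [^] (p ^ j)) \<odot>\<^bsub>M\<^esub> (F ^^ j) z"
      using yM zM c(1) y(2) by (simp add: funpow_minus funpow_smult)
    then show ?case using c span_superset[of ?B] K_pow by (metis imageI subsetD)
  next
    case zero
    then show ?case using span_minus[OF B span_zero[OF B] span_zero[OF B]] K_closed(2) by (intro bexI[of _ \<zero>]) auto
  next
    case (add u v)
    then obtain c e where ce: "c \<in> K" "e \<in> K" "u \<ominus>\<^bsub>M\<^esub> c \<odot>\<^bsub>M\<^esub> (F ^^ j) z \<in> span ?B"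
      "v \<ominus>\<^bsub>M\<^esub> e \<odot>\<^bsub>M\<^esub> (F ^^ j) z \<in> span ?B" by blast
    have "(u \<ominus>\<^bsub>M\<^esub> c \<odot>\<^bsub>M\<^esub> (F ^^ j) z) \<oplus>\<^bsub>M\<^esub> (v \<ominus>\<^bsub>M\<^esub> e \<odot>\<^bsub>M\<^esub> (F ^^ j) z)
      = (u \<oplus>\<^bsub>M\<^esub> v) \<ominus>\<^bsub>M\<^esub> (c \<oplus> e) \<odot>\<^bsub>M\<^esub> (F ^^ j) z"
      using add ce by (simp add: a_minus_def smult_l_distr M.minus_add M.a_ac)
    then show ?case using span_add[OF B ce(3,4)] K_closed ce by metis
  next
    case (smult e v)
    then obtain c where c: "c \<in> K" "v \<ominus>\<^bsub>M\<^esub> c \<odot>\<^bsub>M\<^esub> (F ^^ j) z \<in> span ?B" by blast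
    have "e \<odot>\<^bsub>M\<^esub> (v \<ominus>\<^bsub>M\<^esub> c \<odot>\<^bsub>M\<^esub> (F ^^ j) z) = e \<odot>\<^bsub>M\<^esub> v \<ominus>\<^bsub>M\<^esub> (e \<otimes> c) \<odot>\<^bsub>M\<^esub> (F ^^ j) z"
      using smult c by (simp add: smult_minus smult_assoc1)
    then show ?case using span_smult[OF B smult(1) c(2)] K_closed smult(1) c(1) by metis
  qed
qed

text \<open>Division algorithm: a leading term of \<open>w\<close> is also one for \<open>Suc i\<close>, so it can be subtracted, at the
  price of a further power of \<open>F\<close>; the remainder has a lexicographically smaller exponent.\<close>

lemma funpow_span_orbit_shift:
  assumes stable: "leading_exponents x (Suc i) = leading_exponents x i" and x: "x \<in> carrier M"
    and "length d = Suc (length rs)" "j \<ge> i" "w \<in> span (orbit x i j)" "w \<in> span ((F ^^ j) ` filt rs d)"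
  shows "\<exists>k. (F ^^ k) w \<in> span (orbit x (Suc i) (j + k))"
proof -
  have "wf (lex less_than)" by (intro wf_lex wf_less_than)
  then show ?thesis
    using assms(3-)
  proof (induction d arbitrary: j w rule: wf_induct_rule)
    case (less d)
    note d = less.prems(1)
    \<comment> \<open>An element of the lower layer involves only finitely many generators, so
      \<open>sfilt_cover\<close> moves it to a smaller exponent. The claim is general in
      \<open>j\<close> and \<open>w\<close> because it is also applied to a remainder at a higher
      power of \<open>F\<close>.\<close>
    have smaller: "\<exists>k. (F ^^ k) w \<in> span (orbit x (Suc i) (j + k))"
      if j: "j \<ge> i" and w: "w \<in> span (orbit x i j)" "w \<in> span ((F ^^ j) ` sfilt rs d)" for j w
    proof -
      have sM: "(F ^^ j) ` sfilt rs d \<subseteq> carrier M" using filt_carrier[OF d] by auto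
      obtain B where B: "B \<subseteq> (F ^^ j) ` sfilt rs d" "finite B" "w \<in> span B"
        using span_finite[OF w(2) sM] by blast
      then obtain A where A: "A \<subseteq> sfilt rs d" "finite A" "B = (F ^^ j) ` A"
        by (meson finite_subset_image)
      have "A \<subseteq> {\<zero>\<^bsub>M\<^esub>} \<or> (\<exists>d'. (d', d) \<in> lex less_than \<and> A \<subseteq> filt rs d')"
        using sfilt_cover[OF subset_refl d A(2,1)] by simp
      then show ?thesis
      proof (elim disjE exE conjE)
        assume "A \<subseteq> {\<zero>\<^bsub>M\<^esub>}"
        then have "B \<subseteq> {\<zero>\<^bsub>M\<^esub>}" using A(3) by auto
        moreover have "subspace {\<zero>\<^bsub>M\<^esub>}" by (rule subspaceI) auto
        ultimately have "w = \<zero>\<^bsub>M\<^esub>" using span_minimal[of "{\<zero>\<^bsub>M\<^esub>}" B] B(3) by blast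
        then show ?thesis using span_zero[OF orbit_carrier[OF x]] by simp
      next
        fix d' assume d': "(d', d) \<in> lex less_than" "A \<subseteq> filt rs d'"
        have len: "length d' = Suc (length rs)" using d' d by (auto simp: lex_conv)
        have "w \<in> span ((F ^^ j) ` filt rs d')"
          using B(3) span_mono[OF image_mono[OF d'(2)], of "F ^^ j"] A(3) by blast
        then show ?thesis using less.IH[OF d'(1) len j w(1)] by blast
      qed
    qed
    show ?case
    proof (cases "filt rs d \<subseteq> sfilt rs d")
      case True
      then have "w \<in> span ((F ^^ j) ` sfilt rs d)"
        using less.prems(4) span_mono[OF image_mono[OF True], of "F ^^ j"] by blast
      then show ?thesis using smaller less.prems by blast
    next
      case False
      then obtain z where z: "z \<in> filt rs d" "z \<notin> sfilt rs d" by blast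
      note fM = filt_carrier[OF d]
      have zM: "z \<in> carrier M" using z fM by blast
      have sM: "(F ^^ l) ` sfilt rs d \<subseteq> carrier M" for l using fM by auto
      have oM: "orbit x l m \<subseteq> carrier M" for l m using orbit_carrier[OF x] .
      have wM: "w \<in> carrier M" using less.prems(3) span_carrier[OF oM] by blast
      obtain c where c: "c \<in> K" "w \<ominus>\<^bsub>M\<^esub> c \<odot>\<^bsub>M\<^esub> (F ^^ j) z \<in> span ((F ^^ j) ` sfilt rs d)"
        using span_filt_decompose[OF d z less.prems(4)] by blast
      define w' where "w' = w \<ominus>\<^bsub>M\<^esub> c \<odot>\<^bsub>M\<^esub> (F ^^ j) z"
      have w'M: "w' \<in> carrier M" using wM zM c(1) by (simp add: w'_def)
      have w_eq: "w = w' \<oplus>\<^bsub>M\<^esub> c \<odot>\<^bsub>M\<^esub> (F ^^ j) z"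
        using wM zM c(1) by (simp add: w'_def a_minus_def M.a_assoc M.l_neg)
      show ?thesis
      proof (cases "c = \<zero>")
        case True
        then have "w = w'" using w_eq w'M zM by simp
        then show ?thesis using smaller less.prems(2,3) c(2) w'_def by simp
      next
        case False
        let ?U = "\<lambda>j i. (F ^^ j) ` sfilt rs d \<union> orbit x i j"
        have UM: "?U j i \<subseteq> carrier M" for i j using sM oM by blast
        have wU: "w \<in> span (?U j i)" using less.prems(3) span_mono[of "orbit x i j" "?U j i"] by blast
        have w'U: "w' \<in> span (?U j i)"
          using c(2) span_mono[of "(F ^^ j) ` sfilt rs d" "?U j i"] by (auto simp: w'_def)
        \<comment> \<open>Since \<open>c\<close> is invertible, \<open>(F ^^ j) z\<close> is
          recovered from the difference of \<open>w\<close> and \<open>w'\<close>, so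
          \<open>d\<close> is a leading exponent for \<open>i\<close>. By stability it is one for
          \<open>Suc i\<close>, possibly with another witness \<open>z'\<close> and another power
          \<open>l\<close>.\<close>
        have ci: "inv c \<in> K" "inv c \<otimes> c = \<one>" using K_inv[OF c(1) False] by auto
        have "w \<ominus>\<^bsub>M\<^esub> w' = c \<odot>\<^bsub>M\<^esub> (F ^^ j) z"
          using w'M zM c(1) by (subst w_eq) (simp add: a_minus_def M.a_ac M.r_neg2 M.r_neg1 M.r_neg)
        then have "inv c \<odot>\<^bsub>M\<^esub> (w \<ominus>\<^bsub>M\<^esub> w') = (F ^^ j) z"
          using ci c(1) zM by (simp add: smult_assoc1[symmetric])
        then have "(F ^^ j) z \<in> span (?U j i)"
          using span_smult[OF UM ci(1) span_minus[OF UM wU w'U]] by simp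
        then have "d \<in> leading_exponents x i"
          using d z less.prems(2) unfolding leading_exponents_def by blast
        then obtain z' l where z': "z' \<in> filt rs d" "z' \<notin> sfilt rs d" "l \<ge> Suc i"
          "(F ^^ l) z' \<in> span (?U l (Suc i))"
          using stable unfolding leading_exponents_def by blast
        have z'M: "z' \<in> carrier M" using z' fM by blast
        obtain e where e: "e \<in> K" "z \<ominus>\<^bsub>M\<^esub> e \<odot>\<^bsub>M\<^esub> z' \<in> sfilt rs d"
          using filt_diff[OF subset_refl d z(1) z'(1,2)] by blast
        define z2 where "z2 = z \<ominus>\<^bsub>M\<^esub> e \<odot>\<^bsub>M\<^esub> z'"
        have z2: "z2 \<in> sfilt rs d" "z2 \<in> carrier M" using e zM z'M by (auto simp: z2_def)
        have z_eq: "z = z2 \<oplus>\<^bsub>M\<^esub> e \<odot>\<^bsub>M\<^esub> z'"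
          using zM z'M e(1) by (simp add: z2_def a_minus_def M.a_assoc M.l_neg)
        \<comment> \<open>A common power to which the relations for \<open>w\<close> at
          \<open>j\<close> and for \<open>z'\<close> at \<open>l\<close> are both carried.\<close>
        define J where "J = max j l"
        define k where "k = J - j"
        have J: "J = j + k" "J = l + (J - l)" by (auto simp: J_def k_def)
        have image_U: "(F ^^ (J - l)) ` ?U l (Suc i) \<subseteq> ?U J (Suc i)"
          using funpow_image[of "J - l" l "sfilt rs d"] funpow_orbit[of "J - l" x "Suc i" l] J(2)
          by (auto simp only: image_Un)
        have "(F ^^ J) z' = (F ^^ (J - l)) ((F ^^ l) z')"
          using J(2) by (simp add: funpow_funpow)
        then have "(F ^^ J) z' \<in> span (?U J (Suc i))"
          using funpow_span[OF z'(4) UM, of "J - l"] span_mono[OF image_U] by auto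
        moreover have "(F ^^ J) z2 \<in> span (?U J (Suc i))"
          using z2(1) span_superset[of "?U J (Suc i)"] by blast
        ultimately have "(F ^^ J) z \<in> span (?U J (Suc i))"
          using z_eq z2(2) e(1) z'M span_add[OF UM] span_smult[OF UM] K_pow
          by (simp add: funpow_add funpow_smult)
        moreover have "(F ^^ k) w' \<in> span (?U J (Suc i))"
        proof -
          have "w' \<in> span ((F ^^ j) ` sfilt rs d)" using c(2) by (simp add: w'_def)
          from funpow_span[OF this sM, of k] have "(F ^^ k) w' \<in> span ((F ^^ J) ` sfilt rs d)"
            by (simp only: funpow_image J(1))
          then show ?thesis using span_mono[of "(F ^^ J) ` sfilt rs d" "?U J (Suc i)"] by blast
        qed
        moreover have "(F ^^ k) w = (F ^^ k) w' \<oplus>\<^bsub>M\<^esub> (c [^] (p ^ k)) \<odot>\<^bsub>M\<^esub> (F ^^ J) z"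
        proof -
          have "(F ^^ k) ((F ^^ j) z) = (F ^^ J) z" using J(1) by (simp add: funpow_funpow add.commute)
          then show ?thesis
            using w'M c(1) zM by (subst w_eq) (simp add: funpow_add funpow_smult)
        qed
        ultimately have "(F ^^ k) w \<in> span (?U J (Suc i))"
          using span_add[OF UM] span_smult[OF UM] K_pow[OF c(1)] by simp
        \<comment> \<open>\<open>b\<close> is already expressed by the orbit for
          \<open>Suc i\<close>. The remainder \<open>a\<close> lies in the lower layer and, as a
          difference, still in the span of \<open>orbit x i J\<close>, so \<open>smaller\<close>
          applies to it.\<close>
        then obtain a b where a: "a \<in> span ((F ^^ J) ` sfilt rs d)" and b: "b \<in> span (orbit x (Suc i) J)"
          and ab: "(F ^^ k) w = a \<oplus>\<^bsub>M\<^esub> b"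
          using span_Un[OF _ sM oM] by blast
        have aM: "a \<in> carrier M" and bM: "b \<in> carrier M"
          using a b span_carrier[OF sM] span_carrier[OF oM] by blast+
        have "(F ^^ k) w \<ominus>\<^bsub>M\<^esub> b = a"
          using aM bM by (simp add: ab a_minus_def M.a_assoc M.r_neg)
        moreover have "(F ^^ k) w \<in> span (orbit x i J)"
          using funpow_span_orbit[OF less.prems(3) x] J(1) by simp
        moreover have "b \<in> span (orbit x i J)"
          using b span_mono[OF orbit_Suc_subset] by blast
        ultimately have "a \<in> span (orbit x i J)"
          using span_minus[OF oM] by metis
        then obtain m where m: "(F ^^ m) a \<in> span (orbit x (Suc i) (J + m))"
          using smaller[of J a] a less.prems(2) J(1) by auto
        have "(F ^^ (k + m)) w = (F ^^ m) a \<oplus>\<^bsub>M\<^esub> (F ^^ m) b"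
          using ab aM bM by (metis funpow_add funpow_funpow add.commute)
        also have "\<dots> \<in> span (orbit x (Suc i) (J + m))"
          using span_add[OF oM m funpow_span_orbit[OF b x]] .
        finally show ?thesis using J(1) by (intro exI[of _ "k + m"]) (simp add: add.assoc)
      qed
    qed
  qed
qed

text \<open>Choose \<open>i\<close> where the leading exponents agree with those for
  \<open>Suc i\<close>, and divide \<open>x\<close>, which lies in \<open>orbit x i i\<close>. The
  resulting orbit for \<open>Suc i\<close> at \<open>i + k\<close> consists of the
  \<open>(F ^^ a) x\<close> with \<open>a < k\<close>, so \<open>k\<close> is the required
  \<open>J\<close>.\<close>

lemma orbit_finite_span:
  assumes x: "x \<in> carrier M" and stable: "\<And>j. x \<in> span ((F ^^ j) ` carrier M)"
  obtains J where "(F ^^ J) x \<in> span ((\<lambda>a. (F ^^ a) x) ` {..<J})"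
proof -
  obtain i where i: "leading_exponents x (Suc i) = leading_exponents x i"
    using leading_exponents_stable[OF x] .
  have FM: "(F ^^ i) ` carrier M \<subseteq> carrier M" by auto
  obtain B where B: "B \<subseteq> (F ^^ i) ` carrier M" "finite B" "x \<in> span B"
    using span_finite[OF stable FM] by blast
  then obtain A where A: "A \<subseteq> carrier M" "finite A" "B = (F ^^ i) ` A"
    by (meson finite_subset_image)
  obtain d where d: "length d = Suc (length rs)" "A \<subseteq> filt rs d"
    using filt_cover[OF subset_refl A(2,1)] by auto
  have "x \<in> span ((F ^^ i) ` filt rs d)"
    using B(3) A(3) span_mono[OF image_mono[OF d(2)], of "F ^^ i"] by blast
  moreover have "x \<in> orbit x i i" by (auto simp: orbit_def intro: exI[of _ 0])
  ultimately obtain k where "(F ^^ k) x \<in> span (orbit x (Suc i) (i + k))"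
    using funpow_span_orbit_shift[OF i x d(1) order_refl] span_superset by blast
  moreover have "orbit x (Suc i) (i + k) = (\<lambda>a. (F ^^ a) x) ` {..<k}"
    by (auto simp: orbit_def)
  ultimately show thesis using that by simp
qed

lemma orbit_socle:
  assumes x: "x \<in> carrier M" and stable: "\<And>j. x \<in> span ((F ^^ j) ` carrier M)"
    and r: "r \<in> set rs"
  shows "r \<odot>\<^bsub>M\<^esub> (F ^^ a) x = \<zero>\<^bsub>M\<^esub>"
proof -
  obtain J where J: "(F ^^ J) x \<in> span ((\<lambda>a. (F ^^ a) x) ` {..<J})"
    using orbit_finite_span[OF x stable] .
  let ?G = "(\<lambda>a. (F ^^ a) x) ` {..<J}"
  have G: "?G \<subseteq> carrier M" using x by auto
  have closed: "F v \<in> span ?G" if "v \<in> span ?G" for v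
  proof -
    have "F ` ?G \<subseteq> span ?G"
    proof
      fix y assume "y \<in> F ` ?G"
      then obtain b where b: "b < J" "y = (F ^^ Suc b) x" by auto
      show "y \<in> span ?G"
      proof (cases "Suc b = J")
        case True
        then show ?thesis using b(2) J by (simp only:)
      next
        case False
        then have "Suc b < J" using b(1) by simp
        then have "y \<in> ?G" using b(2) by blast
        then show ?thesis using span_superset[of ?G] by blast
      qed
    qed
    then have "span (F ` ?G) \<subseteq> span ?G" by (rule span_minimal[OF span_subspace[OF G]])
    moreover have "F v \<in> span (F ` ?G)"
      using funpow_span[OF that G, of 1] by (simp only: funpow_0 funpow.simps One_nat_def comp_id)
    ultimately show ?thesis by blast
  qed
  have orb: "(F ^^ b) x \<in> span ?G" for b
  proof (induction b)
    case 0
    show ?case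
    \<comment> \<open>For \<open>J = 0\<close> the generating set is empty and the relation itself
      puts \<open>x\<close> into its span.\<close>
    proof (cases "J = 0")
      case True
      then show ?thesis using J by simp
    next
      case False
      then have "(F ^^ 0) x \<in> ?G" by blast
      then show ?thesis using span_superset[of ?G] by blast
    qed
  next
    case (Suc b)
    then show ?case using closed[OF Suc] by (simp only: funpow.simps o_apply)
  qed
  obtain t :: nat where t: "\<forall>y\<in>?G. (r [^] t) \<odot>\<^bsub>M\<^esub> y = \<zero>\<^bsub>M\<^esub>"
    using torsion_uniform[OF r _ G] by blast
  have rR: "r \<in> carrier R" using r rs_carrier by blast
  have "subspace {v \<in> carrier M. (r [^] t) \<odot>\<^bsub>M\<^esub> v = \<zero>\<^bsub>M\<^esub>}"
    using rR by (intro subspaceI) (auto simp: smult_r_distr smult_comm)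
  then have kill: "(r [^] t) \<odot>\<^bsub>M\<^esub> v = \<zero>\<^bsub>M\<^esub>" if "v \<in> span ?G" for v
    using span_minimal[of _ ?G] t G that by blast
  have "t \<le> p ^ t" using p self_le_ge2_pow by blast
  then have "(r [^] (p ^ t)) \<odot>\<^bsub>M\<^esub> (F ^^ (t + a)) x = \<zero>\<^bsub>M\<^esub>"
    using pow_smult_zero_mono[OF kill[OF orb]] rR x by blast
  then have "(F ^^ t) (r \<odot>\<^bsub>M\<^esub> (F ^^ a) x) = \<zero>\<^bsub>M\<^esub>"
    using rR x by (simp add: funpow_smult funpow_funpow)
  then show ?thesis using funpow_eq_zero rR x by blast
qed

end

section \<open>Artinian modules over local rings with a coefficient field\<close>

text \<open>In a Noetherian ring the union of a nonempty chain of ideals is a member of the chain,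
  so Zorn's lemma applies to the proper ideals above \<open>I\<close>.\<close>

lemma (in noetherian_ring) exists_maximalideal:
  assumes I: "ideal I R" "\<one> \<notin> I"
  obtains J where "maximalideal J R" "I \<subseteq> J"
proof -
  define A where "A = {J. ideal J R \<and> I \<subseteq> J \<and> \<one> \<notin> J}"
  have "\<exists>J\<in>A. \<forall>Y\<in>A. J \<subseteq> Y \<longrightarrow> Y = J"
  proof (rule subset_Zorn_nonempty)
    show "A \<noteq> {}" using I by (auto simp: A_def)
    fix C assume C: "C \<noteq> {}" "subset.chain A C"
    then have "subset.chain {J. ideal J R} C" by (auto simp: subset.chain_def A_def)
    then have "\<Union>C \<in> C" by (rule ideal_chain_is_trivial[OF C(1)])
    then show "\<Union>C \<in> A" using C(2) by (auto simp: subset.chain_def)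
  qed
  then obtain J where JA: "J \<in> A" and max: "\<forall>Y\<in>A. J \<subseteq> Y \<longrightarrow> Y = J"
    by (rule bexE)
  have J: "ideal J R" "I \<subseteq> J" "\<one> \<notin> J" using JA by (simp_all add: A_def)
  have "maximalideal J R"
  proof (rule maximalidealI[OF J(1)])
    show "carrier R \<noteq> J" using J(3) by blast
    fix Y assume Y: "ideal Y R" "J \<subseteq> Y" "Y \<subseteq> carrier R"
    show "Y = J \<or> Y = carrier R"
    proof (cases "\<one> \<in> Y")
      case True
      then show ?thesis using ideal.one_imp_carrier[OF Y(1)] by blast
    next
      case False
      then have "Y \<in> A" using Y J(2) by (simp add: A_def subset_trans[of I J Y])
      then show ?thesis using max Y(2) by simp
    qed
  qed
  then show thesis using J(2) by (rule that)
qed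

lemma (in module) annihilator_ideal:
  assumes "x \<in> carrier M"
  shows "ideal {r \<in> carrier R. r \<odot>\<^bsub>M\<^esub> x = \<zero>\<^bsub>M\<^esub>} R"
proof (rule idealI)
  show "ring R" by (rule R.ring_axioms)
  show "subgroup {r \<in> carrier R. r \<odot>\<^bsub>M\<^esub> x = \<zero>\<^bsub>M\<^esub>} (add_monoid R)"
    using assms
    by (intro R.add.subgroupI) (auto simp: smult_l_distr smult_l_minus a_inv_def[symmetric] intro: exI[of _ \<zero>])
  fix a r assume a: "a \<in> {r \<in> carrier R. r \<odot>\<^bsub>M\<^esub> x = \<zero>\<^bsub>M\<^esub>}" and r: "r \<in> carrier R"
  then show "r \<otimes> a \<in> {r \<in> carrier R. r \<odot>\<^bsub>M\<^esub> x = \<zero>\<^bsub>M\<^esub>}"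
    using assms by (simp add: smult_assoc1)
  then show "a \<otimes> r \<in> {r \<in> carrier R. r \<odot>\<^bsub>M\<^esub> x = \<zero>\<^bsub>M\<^esub>}"
    using a r by (simp add: R.m_comm)
qed

lemma (in module) cyclic_submodule:
  assumes y: "y \<in> carrier M"
  shows "submodule {s \<odot>\<^bsub>M\<^esub> y |s. s \<in> carrier R} R M"
proof (rule submoduleI)
  let ?N = "{s \<odot>\<^bsub>M\<^esub> y |s. s \<in> carrier R}"
  show "?N \<subseteq> carrier M" using y by auto
  show "\<zero>\<^bsub>M\<^esub> \<in> ?N" using smult_l_null[OF y] R.zero_closed by force
  show "\<ominus>\<^bsub>M\<^esub> a \<in> ?N" if "a \<in> ?N" for a
  proof -
    obtain s where s: "s \<in> carrier R" "a = s \<odot>\<^bsub>M\<^esub> y" using \<open>a \<in> ?N\<close> by blast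
    then have "\<ominus>\<^bsub>M\<^esub> a = (\<ominus> s) \<odot>\<^bsub>M\<^esub> y" using y by (simp add: smult_l_minus)
    then show ?thesis using R.a_inv_closed s(1) by blast
  qed
  show "a \<oplus>\<^bsub>M\<^esub> b \<in> ?N" if ab: "a \<in> ?N" "b \<in> ?N" for a b
  proof -
    obtain s t where s: "s \<in> carrier R" "t \<in> carrier R" "a = s \<odot>\<^bsub>M\<^esub> y" "b = t \<odot>\<^bsub>M\<^esub> y"
      using ab by blast
    then have "a \<oplus>\<^bsub>M\<^esub> b = (s \<oplus> t) \<odot>\<^bsub>M\<^esub> y" using y by (simp add: smult_l_distr)
    then show ?thesis using R.add.m_closed s(1,2) by blast
  qed
  show "a \<odot>\<^bsub>M\<^esub> z \<in> ?N" if az: "a \<in> carrier R" "z \<in> ?N" for a z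
  proof -
    obtain s where s: "s \<in> carrier R" "z = s \<odot>\<^bsub>M\<^esub> y" using az by blast
    then have "a \<odot>\<^bsub>M\<^esub> z = (a \<otimes> s) \<odot>\<^bsub>M\<^esub> y" using y az by (simp add: smult_assoc1)
    then show ?thesis using R.m_closed s(1) az(1) by blast
  qed
qed

text \<open>The cyclic submodules generated by \<open>r ^ i x\<close> become stationary, so
  \<open>y = r ^ n x\<close> satisfies \<open>y = s r y\<close>. Then \<open>1 - s r\<close>
  annihilates \<open>y\<close>. A proper annihilator would lie in the maximal ideal together with
  \<open>s r\<close>, forcing \<open>1\<close> into it; hence \<open>y\<close> vanishes.\<close>

lemma artinian_module_torsion:
  assumes noeth: "noetherian_ring R" and local: "local_ring R \<mm>" and art: "artinian_module R M"
    and r: "r \<in> \<mm>" and x: "x \<in> carrier M"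
  shows "\<exists>k::nat. (r [^]\<^bsub>R\<^esub> k) \<odot>\<^bsub>M\<^esub> x = \<zero>\<^bsub>M\<^esub>"
proof -
  interpret module R M using art by (simp add: artinian_module_def)
  interpret noetherian_ring R by fact
  interpret maximalideal \<mm> R using local by (simp add: local_ring_def)
  have rR: "r \<in> carrier R" using r a_subset by blast
  define N where "N i = {s \<odot>\<^bsub>M\<^esub> ((r [^]\<^bsub>R\<^esub> i) \<odot>\<^bsub>M\<^esub> x) |s. s \<in> carrier R}" for i :: nat
  have sub: "submodule (N i) R M" for i
    unfolding N_def using rR x by (intro cyclic_submodule) simp
  have dec: "N (Suc i) \<subseteq> N i" for i
  proof
    fix z assume "z \<in> N (Suc i)"
    then obtain s where s: "s \<in> carrier R" "z = s \<odot>\<^bsub>M\<^esub> ((r [^]\<^bsub>R\<^esub> Suc i) \<odot>\<^bsub>M\<^esub> x)" by (auto simp: N_def)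
    have "z = (s \<otimes>\<^bsub>R\<^esub> r) \<odot>\<^bsub>M\<^esub> ((r [^]\<^bsub>R\<^esub> i) \<odot>\<^bsub>M\<^esub> x)"
      using s rR x by (simp add: smult_assoc1[symmetric] R.m_ac)
    then show "z \<in> N i" using s(1) rR unfolding N_def by blast
  qed
  obtain n where n: "\<forall>i\<ge>n. N i = N n" using art sub dec unfolding artinian_module_def by blast
  define y where "y = (r [^]\<^bsub>R\<^esub> n) \<odot>\<^bsub>M\<^esub> x"
  have y: "y \<in> carrier M" using rR x by (simp add: y_def)
  have "\<one>\<^bsub>R\<^esub> \<odot>\<^bsub>M\<^esub> y \<in> N n" unfolding N_def y_def by blast
  moreover have "N (Suc n) = N n" using n by (meson le_SucI order_refl)
  ultimately have "y \<in> N (Suc n)" using y by simp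
  then obtain s where s: "s \<in> carrier R" "y = s \<odot>\<^bsub>M\<^esub> ((r [^]\<^bsub>R\<^esub> Suc n) \<odot>\<^bsub>M\<^esub> x)" by (auto simp: N_def)
  note s(2)
  moreover have "s \<odot>\<^bsub>M\<^esub> ((r [^]\<^bsub>R\<^esub> Suc n) \<odot>\<^bsub>M\<^esub> x) = (s \<otimes>\<^bsub>R\<^esub> r) \<odot>\<^bsub>M\<^esub> y"
    using rR x s(1) by (simp add: y_def smult_assoc1[symmetric] R.m_ac)
  ultimately have ys: "y = (s \<otimes>\<^bsub>R\<^esub> r) \<odot>\<^bsub>M\<^esub> y" by (rule trans)
  let ?I = "{t \<in> carrier R. t \<odot>\<^bsub>M\<^esub> y = \<zero>\<^bsub>M\<^esub>}"
  have sr: "s \<otimes>\<^bsub>R\<^esub> r \<in> \<mm>" using s(1) r I_l_closed by blast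
  have srR: "s \<otimes>\<^bsub>R\<^esub> r \<in> carrier R" using s(1) rR by simp
  have "(\<one>\<^bsub>R\<^esub> \<ominus>\<^bsub>R\<^esub> s \<otimes>\<^bsub>R\<^esub> r) \<odot>\<^bsub>M\<^esub> y = \<zero>\<^bsub>M\<^esub>"
    using srR y ys[symmetric] by (simp add: a_minus_def smult_l_distr smult_l_minus M.r_neg)
  then have u: "\<one>\<^bsub>R\<^esub> \<ominus>\<^bsub>R\<^esub> s \<otimes>\<^bsub>R\<^esub> r \<in> ?I" using srR by simp
  have "\<one>\<^bsub>R\<^esub> \<in> ?I"
  proof (rule ccontr)
    assume "\<one>\<^bsub>R\<^esub> \<notin> ?I"
    then obtain J where J: "maximalideal J R" "?I \<subseteq> J"
      using exists_maximalideal[OF annihilator_ideal[OF y]] by blast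
    then have "J = \<mm>" using local by (simp add: local_ring_def)
    then have "(\<one>\<^bsub>R\<^esub> \<ominus>\<^bsub>R\<^esub> s \<otimes>\<^bsub>R\<^esub> r) \<oplus>\<^bsub>R\<^esub> s \<otimes>\<^bsub>R\<^esub> r \<in> \<mm>" using u J(2) sr by blast
    then have "\<one>\<^bsub>R\<^esub> \<in> \<mm>" using srR by (simp add: a_minus_def R.a_assoc R.l_neg)
    then show False using one_imp_carrier I_notcarr by blast
  qed
  then have "y = \<zero>\<^bsub>M\<^esub>" using y by simp
  then show ?thesis unfolding y_def by blast
qed

text \<open>Surjectivity of the map from \<open>K\<close> to the residue field provides
  \<open>c\<close> in the same coset as \<open>r\<close>.\<close>

lemma coefficient_field_decompose:
  assumes "coefficient_field R \<mm> K" "ideal \<mm> R" "r \<in> carrier R"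
  shows "\<exists>c\<in>K. \<exists>a\<in>\<mm>. r = a \<oplus>\<^bsub>R\<^esub> c"
proof -
  interpret ideal \<mm> R by fact
  have "bij_betw (\<lambda>x. \<mm> +>\<^bsub>R\<^esub> x) K (a_rcosets\<^bsub>R\<^esub> \<mm>)"
    using assms(1) by (simp add: coefficient_field_def ring_iso_def FactRing_def)
  moreover have "\<mm> +>\<^bsub>R\<^esub> r \<in> a_rcosets\<^bsub>R\<^esub> \<mm>" using assms(3) a_rcosetsI[OF a_subset] by blast
  ultimately obtain c where c: "c \<in> K" "\<mm> +>\<^bsub>R\<^esub> r = \<mm> +>\<^bsub>R\<^esub> c"
    by (auto simp: bij_betw_def)
  have "r \<in> \<mm> +>\<^bsub>R\<^esub> c" using a_rcos_self[OF assms(3)] c(2) by simp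
  then show ?thesis using c(1) by (auto simp: a_r_coset_def')
qed

section \<open>Finite flags from the descending chain condition\<close>

context subfield_module
begin

lemma span_insert:
  assumes W: "subspace W" and e: "e \<in> carrier M" and v: "v \<in> span (insert e W)"
  shows "\<exists>w\<in>W. \<exists>c\<in>K. v = w \<oplus>\<^bsub>M\<^esub> c \<odot>\<^bsub>M\<^esub> e"
proof -
  have "insert e W = W \<union> {e}" by blast
  then obtain a b where ab: "a \<in> span W" "b \<in> span {e}" "v = a \<oplus>\<^bsub>M\<^esub> b"
    using span_Un[of v W "{e}"] v e subspace_carrier[OF W] by auto
  have "subspace {c \<odot>\<^bsub>M\<^esub> e |c. c \<in> K}"
  proof (rule subspaceI)
    show "\<zero>\<^bsub>M\<^esub> \<in> {c \<odot>\<^bsub>M\<^esub> e |c. c \<in> K}" using smult_l_null[OF e] K_closed(2) by force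
    show "a \<oplus>\<^bsub>M\<^esub> b \<in> {c \<odot>\<^bsub>M\<^esub> e |c. c \<in> K}" if ab: "a \<in> {c \<odot>\<^bsub>M\<^esub> e |c. c \<in> K}" "b \<in> {c \<odot>\<^bsub>M\<^esub> e |c. c \<in> K}" for a b
    proof -
      obtain c d where cd: "c \<in> K" "d \<in> K" "a = c \<odot>\<^bsub>M\<^esub> e" "b = d \<odot>\<^bsub>M\<^esub> e" using ab by blast
      then have "a \<oplus>\<^bsub>M\<^esub> b = (c \<oplus> d) \<odot>\<^bsub>M\<^esub> e" using e by (simp add: smult_l_distr)
      then show ?thesis using cd K_closed(7) by blast
    qed
    show "a \<odot>\<^bsub>M\<^esub> x \<in> {c \<odot>\<^bsub>M\<^esub> e |c. c \<in> K}" if ax: "a \<in> K" "x \<in> {c \<odot>\<^bsub>M\<^esub> e |c. c \<in> K}" for a x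
    proof -
      obtain c where c: "c \<in> K" "x = c \<odot>\<^bsub>M\<^esub> e" using ax by blast
      then have "a \<odot>\<^bsub>M\<^esub> x = (a \<otimes> c) \<odot>\<^bsub>M\<^esub> e" using e ax by (simp add: smult_assoc1)
      then show ?thesis using c ax K_closed(6) by blast
    qed
  qed (use e in auto)
  then have "span {e} \<subseteq> {c \<odot>\<^bsub>M\<^esub> e |c. c \<in> K}"
  proof (rule span_minimal)
    have "e = \<one> \<odot>\<^bsub>M\<^esub> e" using e by simp
    then show "{e} \<subseteq> {c \<odot>\<^bsub>M\<^esub> e |c. c \<in> K}" using K_closed(3) by blast
  qed
  moreover have "span W \<subseteq> W" by (rule span_minimal[OF W]) simp
  ultimately show ?thesis using ab by blast
qed

text \<open>Adjoin vectors of \<open>V\<close> one at a time. If \<open>V\<close> were never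
  reached, the chosen vectors would be independent, and the spans of their tails would descend
  strictly forever.\<close>

lemma dcc_flag:
  assumes V: "subspace V"
    and dcc: "\<And>D :: nat \<Rightarrow> _. \<lbrakk>\<And>i. subspace (D i); \<And>i. D i \<subseteq> V; \<And>i. D (Suc i) \<subseteq> D i\<rbrakk> \<Longrightarrow> \<exists>n. D (Suc n) = D n"
  shows "\<exists>S n. flag V S n"
proof -
  define pick where "pick W = (SOME e. e \<in> V - W)" for W
  define next_space where "next_space W = (if W = V then V else span (insert (pick W) W))" for W
  define S where "S i = (next_space ^^ i) {\<zero>\<^bsub>M\<^esub>}" for i
  define e where "e i = pick (S i)" for i
  have S0: "S 0 = {\<zero>\<^bsub>M\<^esub>}" by (simp add: S_def)
  have SSuc: "S (Suc i) = (if S i = V then V else span (insert (e i) (S i)))" for i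
    by (simp add: S_def next_space_def e_def)
  have pick: "e i \<in> V - S i" if "S i \<subseteq> V" "S i \<noteq> V" for i
    using someI_ex[of "\<lambda>e. e \<in> V - S i"] that unfolding e_def pick_def by blast
  have VM: "V \<subseteq> carrier M" using V by (rule subspace_carrier)
  have SV: "subspace (S i) \<and> S i \<subseteq> V" for i
  proof (induction i)
    case 0
    have "subspace {\<zero>\<^bsub>M\<^esub>}" by (rule subspaceI) auto
    then show ?case using S0 subspace_zero[OF V] by simp
  next
    case (Suc i)
    show ?case
    proof (cases "S i = V")
      case True
      then show ?thesis using V SSuc by simp
    next
      case False
      then have ins: "insert (e i) (S i) \<subseteq> V" using Suc pick[of i] by blast
      show ?thesis
        using span_subspace[OF subset_trans[OF ins VM]] span_minimal[OF V ins] False SSuc[of i] by simp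
    qed
  qed
  have mono: "S i \<subseteq> S (Suc i)" for i
  proof (cases "S i = V")
    case False
    then show ?thesis using SSuc[of i] span_superset[of "insert (e i) (S i)"] by simp
  qed (use SSuc[of i] in simp)
  have step: "\<exists>c\<in>K. x \<ominus>\<^bsub>M\<^esub> c \<odot>\<^bsub>M\<^esub> z \<in> S i" if xz: "x \<in> S (Suc i)" "z \<in> S (Suc i)" "z \<notin> S i" for i x z
  proof -
    have ne: "S i \<noteq> V" using xz(2,3) SSuc[of i] by auto
    have Si: "subspace (S i)" using SV by blast
    have span_Si: "S (Suc i) = span (insert (e i) (S i))" using SSuc[of i] ne by simp
    have eM: "e i \<in> carrier M" using pick[of i] ne SV VM by blast
    have SM: "S i \<subseteq> carrier M" using SV VM by blast
    obtain w c where w: "w \<in> S i" "c \<in> K" "x = w \<oplus>\<^bsub>M\<^esub> c \<odot>\<^bsub>M\<^esub> e i"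
      using span_insert[OF Si eM] xz(1) unfolding span_Si by blast
    obtain w' c' where w': "w' \<in> S i" "c' \<in> K" "z = w' \<oplus>\<^bsub>M\<^esub> c' \<odot>\<^bsub>M\<^esub> e i"
      using span_insert[OF Si eM] xz(2) unfolding span_Si by blast
    have wM: "w \<in> carrier M" "w' \<in> carrier M" using w(1) w'(1) SM by blast+
    have "c' \<noteq> \<zero>" using w' xz(3) eM wM by auto
    then have ci: "inv c' \<in> K" "inv c' \<otimes> c' = \<one>" using K_inv w'(2) by auto
    \<comment> \<open>The quotient of the \<open>e i\<close>-coefficients of \<open>x\<close> and
      \<open>z\<close>, which cancels \<open>e i\<close> in the difference.\<close>
    define b where "b = c \<otimes> inv c'"
    have b: "b \<in> K" "b \<otimes> c' = c" using w(2) w'(2) ci K_closed(6) by (auto simp: b_def R.m_assoc)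
    have "b \<odot>\<^bsub>M\<^esub> z = b \<odot>\<^bsub>M\<^esub> w' \<oplus>\<^bsub>M\<^esub> c \<odot>\<^bsub>M\<^esub> e i"
      using w' b wM eM by (simp add: smult_r_distr smult_assoc1[symmetric])
    then have "x \<ominus>\<^bsub>M\<^esub> b \<odot>\<^bsub>M\<^esub> z = w \<ominus>\<^bsub>M\<^esub> b \<odot>\<^bsub>M\<^esub> w'"
      using w b(1) wM eM by (simp add: a_minus_def M.minus_add M.a_ac M.r_neg2 M.r_neg1 M.r_neg)
    then show ?thesis
      using subspace_minus[OF Si w(1) subspace_smult[OF Si b(1) w'(1)]] b(1) by (intro bexI[of _ b]) simp_all
  qed
  have "\<exists>n. S n = V"
  proof (rule ccontr)
    assume "\<nexists>n. S n = V"
    then have ne: "S n \<noteq> V" for n by blast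
    have e: "e i \<in> V" "e i \<notin> S i" "e i \<in> carrier M" for i using pick[of i] ne[of i] SV[of i] VM by blast+
    have eS: "e i \<in> S (Suc i)" for i using SSuc[of i] ne[of i] span_superset[of "insert (e i) (S i)"] by auto
    define D where "D i = span (e ` {i..})" for i
    have eD: "e ` A \<subseteq> carrier M" for A using e(3) by blast
    have "\<exists>n. D (Suc n) = D n"
    proof (rule dcc)
      show "subspace (D i)" for i unfolding D_def using eD by (rule span_subspace)
      show "D i \<subseteq> V" for i unfolding D_def using e(1) by (intro span_minimal[OF V]) blast
      show "D (Suc i) \<subseteq> D i" for i unfolding D_def by (intro span_mono image_mono) auto
    qed
    then obtain n where n: "D (Suc n) = D n" by blast
    have "e n \<in> D (Suc n)" unfolding n unfolding D_def using span_superset[of "e ` {n..}"] by auto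
    then obtain B where B: "B \<subseteq> e ` {Suc n..}" "finite B" "e n \<in> span B"
      using span_finite[OF _ eD] unfolding D_def by blast
    then obtain A where A: "A \<subseteq> {Suc n..}" "finite A" "B = e ` A" by (meson finite_subset_image)
    \<comment> \<open>This also holds for empty \<open>A\<close>, whatever value \<open>Max\<close>
      takes there.\<close>
    then have "A \<subseteq> {n<..<Suc (Max A)}" by (auto simp: less_Suc_eq_le)
    then have "e n \<in> span (e ` {n<..<Suc (Max A)})"
      using A(3) B(3) span_mono[OF image_mono, of A "{n<..<Suc (Max A)}" e] by blast
    moreover have "e n \<notin> span (e ` {n<..<m})" for m
    proof (induction m)
      case 0
      have "span {} \<subseteq> S n" using SV[of n] by (intro span_minimal) blast+
      then show ?case using e(2)[of n] by auto
    next
      case (Suc m)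
      show ?case
      proof (cases "n < m")
        case False
        then have "{n<..<Suc m} = {n<..<m}" by auto
        then show ?thesis using Suc by simp
      next
        case True
        have Smono: "S i \<subseteq> S j" if "i \<le> j" for i j using that mono by (rule lift_Suc_mono_le[rotated])
        let ?W = "span (e ` {n<..<m})"
        have W: "subspace ?W" using eD by (rule span_subspace)
        have WS: "?W \<subseteq> S m"
        proof (rule span_minimal)
          show "subspace (S m)" using SV by blast
          show "e ` {n<..<m} \<subseteq> S m"
          proof
            fix y assume "y \<in> e ` {n<..<m}"
            then obtain k where "y = e k" "Suc k \<le> m" by auto
            then show "y \<in> S m" using eS[of k] Smono[of "Suc k" m] by blast
          qed
        qed
        show ?thesis
        proof
          assume "e n \<in> span (e ` {n<..<Suc m})"
          moreover have "{n<..<Suc m} = insert m {n<..<m}" using True by auto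
          then have "e ` {n<..<Suc m} \<subseteq> insert (e m) ?W"
            using span_superset[of "e ` {n<..<m}"] by auto
          ultimately have "e n \<in> span (insert (e m) ?W)"
            using span_mono[of "e ` {n<..<Suc m}" "insert (e m) ?W"] by blast
          then obtain w c where w: "w \<in> ?W" "c \<in> K" "e n = w \<oplus>\<^bsub>M\<^esub> c \<odot>\<^bsub>M\<^esub> e m"
            using span_insert[OF W e(3)] by blast
          have wM: "w \<in> carrier M" using w(1) span_carrier[OF eD] by blast
          show False
          proof (cases "c = \<zero>")
            case True
            then have "e n = w" using w(3) wM e(3)[of m] by simp
            then show False using Suc w(1) by simp
          next
            case False
            then have ci: "inv c \<in> K" "inv c \<otimes> c = \<one>" using K_inv w(2) by auto
            have "e n \<in> S m" using eS[of n] Smono[of "Suc n" m] \<open>n < m\<close> by auto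
            have Sm: "subspace (S m)" using SV by blast
            have "e n \<ominus>\<^bsub>M\<^esub> w \<in> S m" using subspace_minus[OF Sm \<open>e n \<in> S m\<close>] w(1) WS by blast
            moreover have "e n \<ominus>\<^bsub>M\<^esub> w = c \<odot>\<^bsub>M\<^esub> e m"
              using w wM e(3)[of m] by (simp add: a_minus_def M.a_ac M.r_neg2 M.r_neg1 M.r_neg)
            ultimately have "inv c \<odot>\<^bsub>M\<^esub> (c \<odot>\<^bsub>M\<^esub> e m) \<in> S m" using subspace_smult[OF Sm ci(1)] by simp
            then have "e m \<in> S m" using ci w(2) e(3)[of m] by (simp add: smult_assoc1[symmetric])
            then show False using e(2) by blast
          qed
        qed
      qed
    qed
    ultimately show False by blast
  qed
  then obtain n where n: "S n = V" by blast
  have top: "S i = V" if "i \<ge> n" for i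
    using that by (induction rule: dec_induct) (auto simp: n SSuc)
  have "flag V S n"
    unfolding flag_def using SV mono S0 step top by simp
  then show ?thesis by blast
qed

end

section \<open>The socle as a module over \<open>R\<close> and over \<open>K\<close>\<close>

lemma socle_eq_generators:
  assumes "module R M" "A \<subseteq> carrier R" "\<mm> = genideal R A"
  shows "socle \<mm> M = {x \<in> carrier M. \<forall>r\<in>A. r \<odot>\<^bsub>M\<^esub> x = \<zero>\<^bsub>M\<^esub>}"
proof -
  interpret module R M by fact
  have "\<forall>r\<in>\<mm>. r \<odot>\<^bsub>M\<^esub> x = \<zero>\<^bsub>M\<^esub>" if "x \<in> carrier M" "\<forall>r\<in>A. r \<odot>\<^bsub>M\<^esub> x = \<zero>\<^bsub>M\<^esub>" for x
    using R.genideal_minimal[OF annihilator_ideal[OF that(1)], of A] that(2) assms by blast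
  moreover have "A \<subseteq> \<mm>" using R.genideal_self assms by blast
  ultimately show ?thesis unfolding socle_def by blast
qed

lemma (in subfield_module) socle_subspace:
  assumes "\<mm> \<subseteq> carrier R"
  shows "subspace (socle \<mm> M)"
proof (rule subspaceI)
  fix a x assume a: "a \<in> K" and x: "x \<in> socle \<mm> M"
  have "r \<odot>\<^bsub>M\<^esub> (a \<odot>\<^bsub>M\<^esub> x) = \<zero>\<^bsub>M\<^esub>" if "r \<in> \<mm>" for r
  proof -
    have "r \<odot>\<^bsub>M\<^esub> (a \<odot>\<^bsub>M\<^esub> x) = a \<odot>\<^bsub>M\<^esub> (r \<odot>\<^bsub>M\<^esub> x)"
      using that assms a x by (intro smult_comm) (auto simp: socle_def)
    then show ?thesis using that a x by (simp add: socle_def)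
  qed
  then show "a \<odot>\<^bsub>M\<^esub> x \<in> socle \<mm> M" using a x by (simp add: socle_def)
qed (use assms in \<open>auto simp: socle_def smult_r_distr subset_iff\<close>)

text \<open>On the socle, \<open>R\<close> acts through its residue field, that is, through
  \<open>K\<close>. This turns the chain condition on \<open>R\<close>-submodules into one on
  \<open>K\<close>-subspaces of the socle.\<close>

lemma (in subfield_module) subspace_socle_submodule:
  assumes "coefficient_field R \<mm> K" "ideal \<mm> R" "subspace V" "V \<subseteq> socle \<mm> M"
  shows "submodule V R M"
proof (rule submoduleI)
  show "\<ominus>\<^bsub>M\<^esub> v \<in> V" if "v \<in> V" for v
    using that module.submoduleE(3)[OF module_K assms(3)] by blast
  fix r x assume r: "r \<in> carrier R" and x: "x \<in> V"
  obtain c a where ca: "c \<in> K" "a \<in> \<mm>" "r = a \<oplus> c"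
    using coefficient_field_decompose[OF assms(1,2) r] by blast
  have aR: "a \<in> carrier R" using ca(2) ideal.Icarr[OF assms(2)] by blast
  have xM: "x \<in> carrier M" using x subspace_carrier[OF assms(3)] by blast
  have "a \<odot>\<^bsub>M\<^esub> x = \<zero>\<^bsub>M\<^esub>" using assms(4) x ca(2) by (auto simp: socle_def)
  then have "r \<odot>\<^bsub>M\<^esub> x = c \<odot>\<^bsub>M\<^esub> x" using ca aR xM by (simp add: smult_l_distr)
  then show "r \<odot>\<^bsub>M\<^esub> x \<in> V" using subspace_smult[OF assms(3) ca(1) x] by simp
qed (use subspaceD[OF assms(3)] in auto)

theorem theorem2p8:
  fixes R :: "('a, 'c) ring_scheme"
    and M :: "('a, 'b, 'd) module_scheme"
    and \<mm> K :: "'a set"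
    and p :: nat
    and F :: "'b \<Rightarrow> 'b"
  assumes "noetherian_ring R"
    and "local_ring R \<mm>"
    and "Factorial_Ring.prime p"
    and "has_characteristic R p"
    and "coefficient_field R \<mm> K"
    and "artinian_module R M"
    and "frobenius_action R p M F"
    and "inj_on F (carrier M)"
  shows "(F_stable \<mm> M F \<longleftrightarrow> stable_part R K M F \<noteq> {\<zero>\<^bsub>M\<^esub>})
    \<and> stable_part R K M F \<subseteq> socle \<mm> M"
proof -
  have mod: "module R M" using assms(6) by (simp add: artinian_module_def)
  have sub: "subfield K R" using assms(5) by (simp add: coefficient_field_def)
  have "p \<ge> 2" using assms(3) by (rule prime_ge_2_nat)
  interpret frobenius_module R M K p F
    using mod sub \<open>p \<ge> 2\<close> assms(7,8)
    by (auto simp: frobenius_module_def frobenius_module_axioms_def subfield_module_def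
        subfield_module_axioms_def frobenius_action_def)
  have \<mm>: "ideal \<mm> R" using assms(2) by (simp add: local_ring_def maximalideal_def)
  then have \<mm>R: "\<mm> \<subseteq> carrier R" by (auto dest: ideal.Icarr)
  obtain A where A: "A \<subseteq> carrier R" "finite A" "\<mm> = genideal R A"
    using noetherian_ring.finetely_gen[OF assms(1) \<mm>] by blast
  then obtain rs where rs: "set rs = A" using finite_list by blast
  have A\<mm>: "A \<subseteq> \<mm>" using R.genideal_self A by blast
  let ?S = "socle \<mm> M"
  have soc: "?S = {x \<in> carrier M. \<forall>r\<in>set rs. r \<odot>\<^bsub>M\<^esub> x = \<zero>\<^bsub>M\<^esub>}"
    unfolding rs by (rule socle_eq_generators[OF mod A(1,3)])
  have socM: "?S \<subseteq> carrier M" by (auto simp: socle_def)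
  have socS: "subspace ?S" by (rule socle_subspace[OF \<mm>R])
  have dcc: "\<exists>n. \<forall>i\<ge>n. D i = D n"
    if "\<And>i. subspace (D i)" "\<And>i. D i \<subseteq> ?S" "\<And>i. D (Suc i) \<subseteq> D i" for D :: "nat \<Rightarrow> 'b set"
    using assms(6) subspace_socle_submodule[OF assms(5) \<mm>] that
    unfolding artinian_module_def by blast
  have dcc_step: "\<exists>n. D (Suc n) = D n"
    if D: "\<And>i. subspace (D i)" "\<And>i. D i \<subseteq> ?S" "\<And>i. D (Suc i) \<subseteq> D i" for D :: "nat \<Rightarrow> 'b set"
    using dcc[of D, OF D] by (meson le_SucI order_refl)
  obtain S n where S: "flag ?S S n"
    using dcc_flag[OF socS dcc_step] by blast
  interpret filtered_frobenius_module R M K p F rs S n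
  proof
    show "set rs \<subseteq> carrier R" using rs A by simp
    show "\<exists>k::nat. (r [^]\<^bsub>R\<^esub> k) \<odot>\<^bsub>M\<^esub> x = \<zero>\<^bsub>M\<^esub>" if "r \<in> set rs" "x \<in> carrier M" for r x
      using artinian_module_torsion[OF assms(1,2,6)] that rs A\<mm> by blast
    show "flag {x \<in> carrier M. \<forall>r\<in>set rs. r \<odot>\<^bsub>M\<^esub> x = \<zero>\<^bsub>M\<^esub>} S n"
      using S soc by simp
  qed
  have FM: "(F ^^ j) ` carrier M \<subseteq> carrier M" for j by auto
  have stable_iff: "x \<in> stable_part R K M F \<longleftrightarrow> (\<forall>j\<ge>1. x \<in> span ((F ^^ j) ` carrier M))" for x
    by (auto simp: stable_part_def)
  have stable_orbit: "x \<in> carrier M \<and> (F ^^ a) x \<in> ?S" if x: "x \<in> stable_part R K M F" for x a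
  proof -
    have 1: "x \<in> span ((F ^^ 1) ` carrier M)" using x stable_iff by blast
    then have xM: "x \<in> carrier M" using span_carrier[OF FM] by blast
    \<comment> \<open>The stable part only speaks of \<open>j \<ge> 1\<close>; the missing case
      \<open>j = 0\<close> is membership in \<open>M\<close>.\<close>
    have "x \<in> span ((F ^^ j) ` carrier M)" for j
    proof (cases "j = 0")
      case True
      then show ?thesis using xM span_superset[of "carrier M"] by auto
    qed (use x stable_iff in simp)
    then show ?thesis using orbit_socle[OF xM] soc xM by simp
  qed
  have "stable_part R K M F \<subseteq> ?S"
    using stable_orbit[of _ 0] by auto
  moreover have "F_stable \<mm> M F" if "stable_part R K M F \<noteq> {\<zero>\<^bsub>M\<^esub>}"
  proof -
    have "\<zero>\<^bsub>M\<^esub> \<in> stable_part R K M F" using stable_iff span_zero[OF FM] by blast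
    then obtain x where x: "x \<in> stable_part R K M F" "x \<noteq> \<zero>\<^bsub>M\<^esub>" using \<open>_ \<noteq> _\<close> by blast
    have "?S \<inter> (F ^^ e) ` ?S \<noteq> {\<zero>\<^bsub>M\<^esub>}" for e
    proof -
      have "x \<in> ?S" "(F ^^ e) x \<in> ?S" using stable_orbit[OF x(1), of 0] stable_orbit[OF x(1), of e] by auto
      then have "(F ^^ e) x \<in> ?S \<inter> (F ^^ e) ` ?S" by blast
      moreover have "(F ^^ e) x \<noteq> \<zero>\<^bsub>M\<^esub>" using funpow_eq_zero x(2) stable_orbit[OF x(1)] by blast
      ultimately show ?thesis by blast
    qed
    then show ?thesis unfolding F_stable_def F_unstable_def by blast
  qed
  moreover have "stable_part R K M F \<noteq> {\<zero>\<^bsub>M\<^esub>}" if st: "F_stable \<mm> M F"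
  proof -
    define T where "T e = {x \<in> ?S. (F ^^ e) x \<in> ?S}" for e
    \<comment> \<open>From \<open>r F y = 0\<close> follows \<open>F (r y) = r ^ p F y = 0\<close>,
      and \<open>F\<close> is injective. This makes the sets \<open>T e\<close> a descending
      chain.\<close>
    have descend: "(F ^^ e) x \<in> ?S" if x: "x \<in> carrier M" "(F ^^ Suc e) x \<in> ?S" for x e
    proof -
      have "r \<odot>\<^bsub>M\<^esub> (F ^^ e) x = \<zero>\<^bsub>M\<^esub>" if r: "r \<in> \<mm>" for r
      proof -
        have rR: "r \<in> carrier R" using r \<mm>R by blast
        have "r \<odot>\<^bsub>M\<^esub> (F ^^ Suc e) x = \<zero>\<^bsub>M\<^esub>" using x(2) r unfolding socle_def by blast
        then have "(r [^]\<^bsub>R\<^esub> (1::nat)) \<odot>\<^bsub>M\<^esub> (F ^^ Suc e) x = \<zero>\<^bsub>M\<^esub>" using rR by simp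
        then have "(r [^]\<^bsub>R\<^esub> p) \<odot>\<^bsub>M\<^esub> (F ^^ Suc e) x = \<zero>\<^bsub>M\<^esub>"
          by (rule pow_smult_zero_mono) (use p rR x(1) in auto)
        then have "(F ^^ 1) (r \<odot>\<^bsub>M\<^esub> (F ^^ e) x) = \<zero>\<^bsub>M\<^esub>"
          using rR x(1) by (simp add: F_smult)
        then show ?thesis using funpow_eq_zero rR x(1) by blast
      qed
      then show ?thesis using x(1) by (simp add: socle_def)
    qed
    have "\<exists>n. \<forall>i\<ge>n. T i = T n"
    proof (rule dcc)
      show "T i \<subseteq> ?S" for i by (auto simp: T_def)
      show "T (Suc i) \<subseteq> T i" for i using descend socM unfolding T_def by blast
      show "subspace (T i)" for i
      proof (rule subspaceI)
        show "a \<oplus>\<^bsub>M\<^esub> b \<in> T i" if "a \<in> T i" "b \<in> T i" for a b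
        proof -
          have "a \<in> ?S" "b \<in> ?S" "(F ^^ i) a \<in> ?S" "(F ^^ i) b \<in> ?S" using that by (auto simp: T_def)
          then show ?thesis using subspace_add[OF socS] subsetD[OF socM] by (simp add: T_def funpow_add)
        qed
        show "c \<odot>\<^bsub>M\<^esub> a \<in> T i" if "c \<in> K" "a \<in> T i" for c a
        proof -
          have "a \<in> ?S" "(F ^^ i) a \<in> ?S" using that by (auto simp: T_def)
          then show ?thesis
            using subspace_smult[OF socS] subsetD[OF socM] K_pow \<open>c \<in> K\<close> by (simp add: T_def funpow_smult)
        qed
      qed (use socM subspace_zero[OF socS] in \<open>auto simp: T_def\<close>)
    qed
    then obtain m where m: "\<And>i. i \<ge> m \<Longrightarrow> T i = T m" by blast
    \<comment> \<open>\<open>Suc m\<close> is used as the bound because instability asks for a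
      positive one. With \<open>e\<close> beyond \<open>m\<close>, the \<open>x\<close> found below
      lies in \<open>T e = T m\<close>, so its orbit stays in the socle from index \<open>m\<close>
      on.\<close>
    from st obtain e where e: "e \<ge> Suc m" "?S \<inter> (F ^^ e) ` ?S \<noteq> {\<zero>\<^bsub>M\<^esub>}"
      unfolding F_stable_def F_unstable_def by blast
    have "\<zero>\<^bsub>M\<^esub> \<in> (F ^^ e) ` ?S" using subspace_zero[OF socS] funpow_zero[of e] by (metis imageI)
    then obtain y where "y \<in> ?S \<inter> (F ^^ e) ` ?S" "y \<noteq> \<zero>\<^bsub>M\<^esub>"
      using e(2) subspace_zero[OF socS] by blast
    then obtain x where x: "x \<in> ?S" "(F ^^ e) x \<in> ?S" "(F ^^ e) x \<noteq> \<zero>\<^bsub>M\<^esub>" by blast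
    have xM: "x \<in> carrier M" using x(1) socM by blast
    have x0: "x \<noteq> \<zero>\<^bsub>M\<^esub>" using x(3) by auto
    have "x \<in> T m" using x(1,2) m[of e] e(1) by (auto simp: T_def)
    have orbit: "(F ^^ i) x \<in> ?S" if "i \<ge> m" for i
      using \<open>x \<in> T m\<close> m[OF that] by (auto simp: T_def)
    \<comment> \<open>Once these tail spans are stationary, \<open>D N\<close> equals
      \<open>D (max N j)\<close>, whose generators all lie in the image of \<open>F ^^ j\<close>. So
      \<open>D N\<close> lies in the stable part.\<close>
    define D where "D j = span ((\<lambda>i. (F ^^ i) x) ` {m + j..})" for j
    have DM: "(\<lambda>i. (F ^^ i) x) ` B \<subseteq> carrier M" for B using xM by auto
    have "\<exists>n. \<forall>j\<ge>n. D j = D n"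
    proof (rule dcc)
      show "subspace (D j)" for j unfolding D_def using DM by (rule span_subspace)
      show "D j \<subseteq> ?S" for j unfolding D_def using orbit by (intro span_minimal[OF socS]) auto
      show "D (Suc j) \<subseteq> D j" for j unfolding D_def by (intro span_mono image_mono) auto
    qed
    then obtain N where N: "\<And>j. j \<ge> N \<Longrightarrow> D j = D N" by blast
    have "(F ^^ (m + N)) x \<in> (\<lambda>i. (F ^^ i) x) ` {m + N..}" by blast
    then have "(F ^^ (m + N)) x \<in> D N" unfolding D_def by (rule subsetD[OF span_superset])
    moreover have "D N \<subseteq> span ((F ^^ j) ` carrier M)" for j
    proof -
      have "(\<lambda>i. (F ^^ i) x) ` {m + max N j..} \<subseteq> (F ^^ j) ` carrier M"
      proof
        fix y assume "y \<in> (\<lambda>i. (F ^^ i) x) ` {m + max N j..}"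
        then obtain i where "i \<ge> m + max N j" and y: "y = (F ^^ i) x" by auto
        then have "i \<ge> j" by simp
        then have "y = (F ^^ j) ((F ^^ (i - j)) x)" by (simp add: y funpow_funpow)
        then show "y \<in> (F ^^ j) ` carrier M" using xM by blast
      qed
      then have "D (max N j) \<subseteq> span ((F ^^ j) ` carrier M)" unfolding D_def by (rule span_mono)
      then show ?thesis using N[of "max N j"] by simp
    qed
    ultimately have "(F ^^ (m + N)) x \<in> stable_part R K M F" using stable_iff by blast
    moreover have "(F ^^ (m + N)) x \<noteq> \<zero>\<^bsub>M\<^esub>" using funpow_eq_zero xM x0 by blast
    ultimately show ?thesis by blast
  qed
  ultimately show ?thesis by blast
qed

end
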